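(* Let $F\colon\mathsf{SKB}\to\mathsf{Grp}$ be the reflector from skew braces to groups. Let $B$ be a skew brace, let $P$ be the free skew brace on the underlying set of $B$, and let $$0\to K\to P\xrightarrow{\,p\,} B\to 0$$ be the corresponding free presentation, where $p$ is the canonical surjection and $K=\operatorname{Ker}(p)$. Then the first homology group of $B$ with coefficients in $F$ is $$\mathsf{H}_1(B,F)=\frac{B}{[B,B]_{\mathsf{Grp}}},$$ and the second homology group of $B$ with coefficients in $F$ is given by the Hopf formula $$\mathsf{H}_2(B,F)\cong\frac{K\cap[P,P]_{\mathsf{Grp}}}{[K,P]_{\mathsf{Grp}}}.$$ In particular, the right-hand side is an invariant of $B$: up to isomorphism it does not depend on the choice of the free presentation of $B$.
   Context: A skew brace is a triple $(A,+,\circ)$ where $(A,+)$ and $(A,\circ)$ are groups such that $a\circ(b+c)=a\circ b-a+a\circ c$ for all $a,b,c\in A$. $\mathsf{SKB}$ is the category (variety) of skew braces. Put $a*b=-a+a\circ b-b$. An ideal of $A$ is a normal subgroup $I$ of $(A,+)$ with $a*x, x*a\in I$ for all $a\in A$, $x\in I$. For an ideal $I$ of $A$, $[I,A]_{\mathsf{Grp}}$ is the subgroup of $(A,+)$ generated by $\{a*b,\ b*a,\ c+b*a-c\mid a\in I,\ b,c\in A\}$; it is an ideal of $A$. In particular $[A,A]_{\mathsf{Grp}}=A*A$ is the additive subgroup generated by all $a*b$, $a,b\in A$. $\mathsf{Grp}$ is identified with the full subcategory of $\mathsf{SKB}$ of skew braces whose two operations coincide; the reflector $F$, left adjoint to the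 inclusion, is $F(A)=A/(A*A)$. A free presentation of $B$ is a short exact sequence $0\to K\to P\to B\to 0$ in $\mathsf{SKB}$ with $P$ a free skew brace. Comonadic homology: let $\mathbb{G}=(G,\epsilon,\delta)$ be the comonad on $\mathsf{SKB}$ induced by the adjunction between the forgetful functor to sets and the free skew brace functor, so $G(B)$ is the free skew brace on the underlying set of $B$ and $\epsilon_B\colon G(B)\to B$ is the canonical surjection. It yields a simplicial object $\mathbb{G}(B)$ with $n$-th term $G^{n+1}(B)$ and faces $d_i=G^{i}(\epsilon_{G^{n-i}(B)})$, $0\le i\le n$. Apply $F$ degreewise to get a simplicial object in $\mathsf{Grp}$ and take its Moore normalization $N$ (the chain complex whose $n$-th term is the intersection of the kernels of all but one extreme face map, with differential the remaining face). Then $\mathsf{H}_n(B,F)$, $n\ge1$, is the homology of $N(F(\mathbb{G}(B)))$ in degree $n-1$ (so that $\mathsf{H}_1(B,F)\cong F(B)$). *)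

theory Defs
  imports "HOL-Algebra.Generated_Groups" "HOL-Algebra.Weak_Morphisms"
begin

section \<open>Skew braces\<close>

text \<open>
  A skew brace is carried by the record type of rings: \<open>\<oplus>\<close>, \<open>\<zero>\<close>, \<open>\<ominus>\<close> are the (not necessarily
  commutative) group \<open>(A,+)\<close>, and \<open>\<otimes>\<close>, \<open>\<one>\<close>, \<open>inv\<close> are the group \<open>(A,\<circ>)\<close>.
\<close>

locale skew_brace =
  fixes A (structure)
  assumes add_group: "group (add_monoid A)"
    and circ_group: "group A"
    and brace: "\<lbrakk>a \<in> carrier A; b \<in> carrier A; c \<in> carrier A\<rbrakk>
      \<Longrightarrow> a \<otimes> (b \<oplus> c) = (a \<otimes> b \<ominus> a) \<oplus> (a \<otimes> c)"

definition sb_hom :: "('a, 'm) ring_scheme \<Rightarrow> ('b, 'n) ring_scheme \<Rightarrow> ('a \<Rightarrow> 'b) set"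
  where "sb_hom A B = hom (add_monoid A) (add_monoid B) \<inter> hom A B"

definition star :: "('a, 'm) ring_scheme \<Rightarrow> 'a \<Rightarrow> 'a \<Rightarrow> 'a"
  where "star A a b = (\<ominus>\<^bsub>A\<^esub> a \<oplus>\<^bsub>A\<^esub> (a \<otimes>\<^bsub>A\<^esub> b)) \<ominus>\<^bsub>A\<^esub> b"

text \<open>\<open>comm_Grp A I\<close> is \<open>[I, A]\<close> relative to the subvariety of groups.\<close>

definition comm_Grp :: "('a, 'm) ring_scheme \<Rightarrow> 'a set \<Rightarrow> 'a set"
  where "comm_Grp A I = generate (add_monoid A)
    (\<Union>a\<in>I. \<Union>b\<in>carrier A. \<Union>c\<in>carrier A.
       {star A a b, star A b a, (c \<oplus>\<^bsub>A\<^esub> star A b a) \<ominus>\<^bsub>A\<^esub> c})"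

definition star_ideal :: "('a, 'm) ring_scheme \<Rightarrow> 'a set"
  where "star_ideal A = generate (add_monoid A)
    (\<Union>a\<in>carrier A. \<Union>b\<in>carrier A. {star A a b})"

text \<open>
  The reflector \<open>F(A) = A/(A*A)\<close> onto groups. The two operations of the quotient coincide, so it
  is recorded as a group, with the operation induced by \<open>\<oplus>\<close>; \<open>refl_map\<close> is its action on
  homomorphisms \<open>f : A \<rightarrow> B\<close>.
\<close>

definition reflector :: "('a, 'm) ring_scheme \<Rightarrow> 'a set monoid"
  where "reflector A = add_monoid A Mod star_ideal A"

definition refl_map :: "('b, 'n) ring_scheme \<Rightarrow> ('a \<Rightarrow> 'b) \<Rightarrow> 'a set \<Rightarrow> 'b set"
  where "refl_map B f c = (\<Union>x\<in>c. star_ideal B #>\<^bsub>add_monoid B\<^esub> f x)"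


section \<open>Free skew braces\<close>

datatype 'a sbterm =
    Gen 'a
  | Zero | Neg "'a sbterm" | Add "'a sbterm" "'a sbterm"
  | One | Inv "'a sbterm" | Circ "'a sbterm" "'a sbterm"

text \<open>The least congruence on terms forced by the axioms of skew braces.\<close>

inductive sb_eq :: "'a sbterm \<Rightarrow> 'a sbterm \<Rightarrow> bool" where
  refl: "sb_eq s s"
| sym: "sb_eq s t \<Longrightarrow> sb_eq t s"
| trans: "sb_eq s t \<Longrightarrow> sb_eq t u \<Longrightarrow> sb_eq s u"
| cong_neg: "sb_eq s t \<Longrightarrow> sb_eq (Neg s) (Neg t)"
| cong_add: "sb_eq s s' \<Longrightarrow> sb_eq t t' \<Longrightarrow> sb_eq (Add s t) (Add s' t')"
| cong_inv: "sb_eq s t \<Longrightarrow> sb_eq (Inv s) (Inv t)"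
| cong_circ: "sb_eq s s' \<Longrightarrow> sb_eq t t' \<Longrightarrow> sb_eq (Circ s t) (Circ s' t')"
| add_assoc: "sb_eq (Add (Add s t) u) (Add s (Add t u))"
| add_zero: "sb_eq (Add Zero s) s"
| add_neg: "sb_eq (Add (Neg s) s) Zero"
| circ_assoc: "sb_eq (Circ (Circ s t) u) (Circ s (Circ t u))"
| circ_one: "sb_eq (Circ One s) s"
| circ_inv: "sb_eq (Circ (Inv s) s) One"
| brace: "sb_eq (Circ s (Add t u)) (Add (Add (Circ s t) (Neg s)) (Circ s u))"

definition sb_class :: "'a set \<Rightarrow> 'a sbterm \<Rightarrow> 'a sbterm set"
  where "sb_class X t = {s. set_sbterm s \<subseteq> X \<and> sb_eq s t}"

definition free_sb :: "'a set \<Rightarrow> 'a sbterm set ring"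
  where "free_sb X =
    \<lparr>carrier = sb_class X ` {t. set_sbterm t \<subseteq> X},
     mult = (\<lambda>c d. \<Union>s\<in>c. \<Union>t\<in>d. sb_class X (Circ s t)),
     one = sb_class X One,
     zero = sb_class X Zero,
     add = (\<lambda>c d. \<Union>s\<in>c. \<Union>t\<in>d. sb_class X (Add s t))\<rparr>"

definition free_gen :: "'a set \<Rightarrow> 'a \<Rightarrow> 'a sbterm set"
  where "free_gen X x = sb_class X (Gen x)"

primrec sb_eval :: "('b, 'm) ring_scheme \<Rightarrow> ('a \<Rightarrow> 'b) \<Rightarrow> 'a sbterm \<Rightarrow> 'b" where
  "sb_eval C f (Gen x) = f x"
| "sb_eval C f Zero = \<zero>\<^bsub>C\<^esub>"
| "sb_eval C f (Neg t) = \<ominus>\<^bsub>C\<^esub> sb_eval C f t"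
| "sb_eval C f (Add s t) = sb_eval C f s \<oplus>\<^bsub>C\<^esub> sb_eval C f t"
| "sb_eval C f One = \<one>\<^bsub>C\<^esub>"
| "sb_eval C f (Inv t) = inv\<^bsub>C\<^esub> sb_eval C f t"
| "sb_eval C f (Circ s t) = sb_eval C f s \<otimes>\<^bsub>C\<^esub> sb_eval C f t"

text \<open>
  The homomorphism \<open>free_sb X \<rightarrow> C\<close> extending \<open>f : X \<rightarrow> C\<close>; all terms in a class have the same
  value (lemmas \<open>free_lift_class\<close>, \<open>free_lift_hom\<close> and \<open>free_sb_hom_unique\<close> below).
\<close>

definition free_lift :: "('b, 'm) ring_scheme \<Rightarrow> ('a \<Rightarrow> 'b) \<Rightarrow> 'a sbterm set \<Rightarrow> 'b"
  where "free_lift C f c = the_elem (sb_eval C f ` c)"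

definition is_free_on :: "('a, 'm) ring_scheme \<Rightarrow> 'a set \<Rightarrow> bool"
  where "is_free_on P X \<longleftrightarrow> X \<subseteq> carrier P \<and>
    bij_betw (free_lift P (\<lambda>x. x)) (carrier (free_sb X)) (carrier P)"

definition sb_kernel :: "('a, 'm) ring_scheme \<Rightarrow> ('b, 'n) ring_scheme \<Rightarrow> ('a \<Rightarrow> 'b) \<Rightarrow> 'a set"
  where "sb_kernel P B p = kernel (add_monoid P) (add_monoid B) p"

text \<open>The exact sequence \<open>0 \<rightarrow> K \<rightarrow> P \<rightarrow> B \<rightarrow> 0\<close> is given by \<open>p\<close>, with \<open>K = sb_kernel P B p\<close>.\<close>

definition free_presentation ::
    "('p, 'm) ring_scheme \<Rightarrow> ('b, 'n) ring_scheme \<Rightarrow> ('p \<Rightarrow> 'b) \<Rightarrow> bool"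
  where "free_presentation P B p \<longleftrightarrow> skew_brace P \<and> (\<exists>X. is_free_on P X) \<and>
    p \<in> sb_hom P B \<and> p ` carrier P = carrier B"

text \<open>\<open>(K \<inter> [P,P]) / [K,P]\<close>\<close>

definition hopf_quotient :: "('p, 'm) ring_scheme \<Rightarrow> 'p set \<Rightarrow> 'p set monoid"
  where "hopf_quotient P K =
    (add_monoid P)\<lparr>carrier := K \<inter> comm_Grp P (carrier P)\<rparr> Mod comm_Grp P K"


section \<open>Homology of simplicial groups\<close>

text \<open>
  A simplicial group enters only through its groups \<open>X n\<close> and faces \<open>d n i : X n \<rightarrow> X (n - 1)\<close>,
  \<open>0 \<le> i \<le> n\<close>, \<open>n \<ge> 1\<close>. The differential of the Moore normalization is the last face.
\<close>

definition moore :: "(nat \<Rightarrow> 'g monoid) \<Rightarrow> (nat \<Rightarrow> nat \<Rightarrow> 'g \<Rightarrow> 'g) \<Rightarrow> nat \<Rightarrow> 'g set"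
  where "moore X d n = {x \<in> carrier (X n). \<forall>i<n. d n i x = \<one>\<^bsub>X (n - 1)\<^esub>}"

definition moore_cycles :: "(nat \<Rightarrow> 'g monoid) \<Rightarrow> (nat \<Rightarrow> nat \<Rightarrow> 'g \<Rightarrow> 'g) \<Rightarrow> nat \<Rightarrow> 'g set"
  where "moore_cycles X d n = {x \<in> moore X d n. n = 0 \<or> d n n x = \<one>\<^bsub>X (n - 1)\<^esub>}"

definition moore_boundaries :: "(nat \<Rightarrow> 'g monoid) \<Rightarrow> (nat \<Rightarrow> nat \<Rightarrow> 'g \<Rightarrow> 'g) \<Rightarrow> nat \<Rightarrow> 'g set"
  where "moore_boundaries X d n = d (Suc n) (Suc n) ` moore X d (Suc n)"

definition moore_homology ::
    "(nat \<Rightarrow> 'g monoid) \<Rightarrow> (nat \<Rightarrow> nat \<Rightarrow> 'g \<Rightarrow> 'g) \<Rightarrow> nat \<Rightarrow> 'g set monoid"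
  where "moore_homology X d n =
    (X n)\<lparr>carrier := moore_cycles X d n\<rparr> Mod moore_boundaries X d n"


section \<open>Comonadic homology\<close>

text \<open>
  The iterates \<open>G\<^sup>n(B)\<close> have to live in one type for \<open>n\<close> to be a variable. The type \<open>'a tower\<close>
  contains a copy \<open>Base\<close> of \<open>'a\<close> and a word for every term over itself; a free skew brace on a
  subset of \<open>'a tower\<close> is moved back into \<open>'a tower\<close> along the injection that picks a term from
  each class.
\<close>

datatype 'a tower = Base 'a | Word "'a tower sbterm"

definition code_word :: "'a tower sbterm set \<Rightarrow> 'a tower"
  where "code_word c = Word (SOME t. t \<in> c)"

definition G_obj :: "'a tower ring \<Rightarrow> 'a tower ring"
  where "G_obj A = image_ring code_word (free_sb (carrier A))"

definition G_gen :: "'a tower ring \<Rightarrow> 'a tower \<Rightarrow> 'a tower"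
  where "G_gen A x = code_word (free_gen (carrier A) x)"

definition G_lift ::
    "'a tower ring \<Rightarrow> 'a tower ring \<Rightarrow> ('a tower \<Rightarrow> 'a tower) \<Rightarrow> 'a tower \<Rightarrow> 'a tower"
  where "G_lift A C f w = free_lift C f (inv_into (carrier (free_sb (carrier A))) code_word w)"

definition G_map ::
    "'a tower ring \<Rightarrow> 'a tower ring \<Rightarrow> ('a tower \<Rightarrow> 'a tower) \<Rightarrow> 'a tower \<Rightarrow> 'a tower"
  where "G_map A C f = G_lift A (G_obj C) (\<lambda>x. G_gen C (f x))"

definition G_counit :: "'a tower ring \<Rightarrow> 'a tower \<Rightarrow> 'a tower"
  where "G_counit A = G_lift A A (\<lambda>x. x)"

primrec G_map_pow ::
    "nat \<Rightarrow> 'a tower ring \<Rightarrow> 'a tower ring \<Rightarrow> ('a tower \<Rightarrow> 'a tower) \<Rightarrow> 'a tower \<Rightarrow> 'a tower" where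
  "G_map_pow 0 A C f = f"
| "G_map_pow (Suc i) A C f = G_map ((G_obj ^^ i) A) ((G_obj ^^ i) C) (G_map_pow i A C f)"

definition G_simp :: "'a tower ring \<Rightarrow> nat \<Rightarrow> 'a tower ring"
  where "G_simp A n = (G_obj ^^ Suc n) A"

definition G_face :: "'a tower ring \<Rightarrow> nat \<Rightarrow> nat \<Rightarrow> 'a tower \<Rightarrow> 'a tower"
  where "G_face A n i =
    G_map_pow i ((G_obj ^^ Suc (n - i)) A) ((G_obj ^^ (n - i)) A) (G_counit ((G_obj ^^ (n - i)) A))"

definition comonadic_homology :: "nat \<Rightarrow> 'a ring \<Rightarrow> 'a tower set set monoid"
  where "comonadic_homology n B = (let A = image_ring Base B in
    moore_homology (\<lambda>k. reflector (G_simp A k))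
      (\<lambda>k i. refl_map (G_simp A (k - 1)) (G_face A k i)) (n - 1))"


section \<open>The universal property of the free skew brace\<close>

lemma sb_eval_closed:
  assumes "skew_brace C" "\<And>x. x \<in> set_sbterm t \<Longrightarrow> f x \<in> carrier C"
  shows "sb_eval C f t \<in> carrier C"
proof -
  interpret skew_brace C by fact
  interpret a: group "add_monoid C" by (rule add_group)
  interpret m: group C by (rule circ_group)
  show ?thesis using assms(2)
    using a.inv_closed a.m_closed a.one_closed
    by (induction t) (auto simp: a_inv_def)
qed

lemma sb_eval_eq_total:
  assumes "skew_brace C" "sb_eq s t" "\<And>x. f x \<in> carrier C"
  shows "sb_eval C f s = sb_eval C f t"
proof -
  interpret skew_brace C by fact
  interpret a: group "add_monoid C" by (rule add_group)
  interpret m: group C by (rule circ_group)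
  have cl: "sb_eval C f u \<in> carrier C" for u
    by (rule sb_eval_closed[OF assms(1)]) (rule assms(3))
  show ?thesis using assms(2)
  proof induction
    case (sym s t) then show ?case by simp
  next
    case (trans s t u) then show ?case by simp
  next
    case (add_assoc s t u) show ?case using a.m_assoc cl by simp
  next
    case (add_zero s) show ?case using a.l_one cl by simp
  next
    case (add_neg s) show ?case using a.l_inv cl by (simp add: a_inv_def)
  next
    case (circ_assoc s t u) show ?case using m.m_assoc[OF cl cl cl] by simp
  next
    case (circ_one s) show ?case using m.l_one[OF cl] by simp
  next
    case (circ_inv s) show ?case using m.l_inv[OF cl] by simp
  next
    case (brace s t u) show ?case
      using skew_brace.brace[OF assms(1) cl cl cl] by (simp add: a_minus_def)
  qed simp_all
qed

lemma sb_eval_cong: "(\<And>x. x \<in> set_sbterm t \<Longrightarrow> f x = g x) \<Longrightarrow> sb_eval C f t = sb_eval C g t"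
  by (induction t) auto

lemma sb_eval_eq:
  assumes "skew_brace C" "sb_eq s t" "f \<in> X \<rightarrow> carrier C" "set_sbterm s \<subseteq> X" "set_sbterm t \<subseteq> X"
  shows "sb_eval C f s = sb_eval C f t"
proof -
  define g where "g x = (if x \<in> X then f x else \<zero>\<^bsub>C\<^esub>)" for x
  have "\<zero>\<^bsub>C\<^esub> \<in> carrier C"
    using group.is_monoid[OF skew_brace.add_group[OF assms(1)]] monoid.one_closed by fastforce
  then have "\<And>x. g x \<in> carrier C" using assms(3) by (auto simp: g_def)
  then have "sb_eval C g s = sb_eval C g t"
    by (rule sb_eval_eq_total[OF assms(1,2)])
  moreover have "sb_eval C f s = sb_eval C g s" "sb_eval C f t = sb_eval C g t"
    using assms(4,5) by (auto intro!: sb_eval_cong simp: g_def)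
  ultimately show ?thesis by simp
qed

lemma sb_class_self: "set_sbterm t \<subseteq> X \<Longrightarrow> t \<in> sb_class X t"
  by (simp add: sb_class_def sb_eq.refl)

lemma sb_class_eqI: "sb_eq s t \<Longrightarrow> sb_class X s = sb_class X t"
  unfolding sb_class_def by (meson sb_eq.sym sb_eq.trans)

lemma free_sb_add:
  assumes "set_sbterm s \<subseteq> X" "set_sbterm t \<subseteq> X"
  shows "sb_class X s \<oplus>\<^bsub>free_sb X\<^esub> sb_class X t = sb_class X (Add s t)"
proof -
  let ?S = "sb_class X s" and ?T = "sb_class X t"
  have "sb_class X (Add s' t') = sb_class X (Add s t)" if "s' \<in> ?S" "t' \<in> ?T" for s' t'
    using that by (intro sb_class_eqI sb_eq.cong_add) (auto simp: sb_class_def)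
  then have "(\<Union>s'\<in>?S. \<Union>t'\<in>?T. sb_class X (Add s' t')) = (\<Union>s'\<in>?S. \<Union>t'\<in>?T. sb_class X (Add s t))"
    by simp
  also have "\<dots> = sb_class X (Add s t)"
    using sb_class_self[OF assms(1)] sb_class_self[OF assms(2)] by (auto simp del: UN_simps)
  finally show ?thesis by (simp add: free_sb_def)
qed

lemma free_sb_mult:
  assumes "set_sbterm s \<subseteq> X" "set_sbterm t \<subseteq> X"
  shows "sb_class X s \<otimes>\<^bsub>free_sb X\<^esub> sb_class X t = sb_class X (Circ s t)"
proof -
  let ?S = "sb_class X s" and ?T = "sb_class X t"
  have "sb_class X (Circ s' t') = sb_class X (Circ s t)" if "s' \<in> ?S" "t' \<in> ?T" for s' t'
    using that by (intro sb_class_eqI sb_eq.cong_circ) (auto simp: sb_class_def)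
  then have "(\<Union>s'\<in>?S. \<Union>t'\<in>?T. sb_class X (Circ s' t')) = (\<Union>s'\<in>?S. \<Union>t'\<in>?T. sb_class X (Circ s t))"
    by simp
  also have "\<dots> = sb_class X (Circ s t)"
    using sb_class_self[OF assms(1)] sb_class_self[OF assms(2)] by (auto simp del: UN_simps)
  finally show ?thesis by (simp add: free_sb_def)
qed

lemma free_sb_carrier: "carrier (free_sb X) = sb_class X ` {t. set_sbterm t \<subseteq> X}"
  and free_sb_zero: "\<zero>\<^bsub>free_sb X\<^esub> = sb_class X Zero"
  and free_sb_one: "\<one>\<^bsub>free_sb X\<^esub> = sb_class X One"
  by (auto simp: free_sb_def)

lemma free_sb_add_group: "group (add_monoid (free_sb X))"
proof (rule groupI, goal_cases)
  case (1 x y) then show ?case by (auto simp: free_sb_carrier free_sb_add)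
next
  case 2 then show ?case by (auto simp: free_sb_carrier free_sb_zero)
next
  case (3 x y z) then show ?case
    by (auto simp: free_sb_carrier free_sb_add sb_class_eqI[OF sb_eq.add_assoc])
next
  case (4 x) then show ?case
    by (auto simp: free_sb_carrier free_sb_add free_sb_zero sb_class_eqI[OF sb_eq.add_zero])
next
  case (5 x)
  then obtain t where t: "x = sb_class X t" "set_sbterm t \<subseteq> X" by (auto simp: free_sb_carrier)
  have "sb_class X (Neg t) \<in> carrier (free_sb X)" using t by (auto simp: free_sb_carrier)
  moreover have "sb_class X (Neg t) \<oplus>\<^bsub>free_sb X\<^esub> x = \<zero>\<^bsub>free_sb X\<^esub>"
    using t by (auto simp: free_sb_add free_sb_zero sb_class_eqI[OF sb_eq.add_neg])
  ultimately show ?case by auto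
qed

lemma free_sb_circ_group: "group (free_sb X)"
proof (rule groupI, goal_cases)
  case (1 x y) then show ?case by (auto simp: free_sb_carrier free_sb_mult)
next
  case 2 then show ?case by (auto simp: free_sb_carrier free_sb_one)
next
  case (3 x y z) then show ?case
    by (auto simp: free_sb_carrier free_sb_mult sb_class_eqI[OF sb_eq.circ_assoc])
next
  case (4 x) then show ?case
    by (auto simp: free_sb_carrier free_sb_mult free_sb_one sb_class_eqI[OF sb_eq.circ_one])
next
  case (5 x)
  then obtain t where t: "x = sb_class X t" "set_sbterm t \<subseteq> X" by (auto simp: free_sb_carrier)
  have "sb_class X (Inv t) \<in> carrier (free_sb X)" using t by (auto simp: free_sb_carrier)
  moreover have "sb_class X (Inv t) \<otimes>\<^bsub>free_sb X\<^esub> x = \<one>\<^bsub>free_sb X\<^esub>"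
    using t by (auto simp: free_sb_mult free_sb_one sb_class_eqI[OF sb_eq.circ_inv])
  ultimately show ?case by auto
qed

lemma free_sb_neg:
  assumes "set_sbterm t \<subseteq> X"
  shows "\<ominus>\<^bsub>free_sb X\<^esub> sb_class X t = sb_class X (Neg t)"
proof -
  have "sb_class X (Neg t) \<oplus>\<^bsub>free_sb X\<^esub> sb_class X t = \<zero>\<^bsub>free_sb X\<^esub>"
    using assms by (auto simp: free_sb_add free_sb_zero sb_class_eqI[OF sb_eq.add_neg])
  then show ?thesis
    using group.inv_equality[OF free_sb_add_group, of X "sb_class X (Neg t)" "sb_class X t"] assms
    by (auto simp: a_inv_def free_sb_carrier)
qed

lemma free_sb_inv:
  assumes "set_sbterm t \<subseteq> X"
  shows "inv\<^bsub>free_sb X\<^esub> sb_class X t = sb_class X (Inv t)"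
proof -
  have "sb_class X (Inv t) \<otimes>\<^bsub>free_sb X\<^esub> sb_class X t = \<one>\<^bsub>free_sb X\<^esub>"
    using assms by (auto simp: free_sb_mult free_sb_one sb_class_eqI[OF sb_eq.circ_inv])
  then show ?thesis
    using group.inv_equality[OF free_sb_circ_group, of X "sb_class X (Inv t)" "sb_class X t"] assms
    by (auto simp: free_sb_carrier)
qed

lemma skew_brace_free_sb: "skew_brace (free_sb X)"
proof (rule skew_brace.intro)
  show "group (add_monoid (free_sb X))" by (rule free_sb_add_group)
  show "group (free_sb X)" by (rule free_sb_circ_group)
next
  fix a b c
  assume "a \<in> carrier (free_sb X)" "b \<in> carrier (free_sb X)" "c \<in> carrier (free_sb X)"
  then show "a \<otimes>\<^bsub>free_sb X\<^esub> (b \<oplus>\<^bsub>free_sb X\<^esub> c) =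
      (a \<otimes>\<^bsub>free_sb X\<^esub> b \<ominus>\<^bsub>free_sb X\<^esub> a) \<oplus>\<^bsub>free_sb X\<^esub> (a \<otimes>\<^bsub>free_sb X\<^esub> c)"
    by (auto simp: free_sb_carrier free_sb_add free_sb_mult free_sb_neg a_minus_def
        sb_class_eqI[OF sb_eq.brace])
qed

lemma free_lift_class:
  assumes "skew_brace C" "f \<in> X \<rightarrow> carrier C" "set_sbterm t \<subseteq> X"
  shows "free_lift C f (sb_class X t) = sb_eval C f t"
proof -
  let ?v = "sb_eval C f t"
  have "sb_eval C f ` sb_class X t = (\<lambda>_. ?v) ` sb_class X t"
  proof (rule image_cong)
    fix s assume "s \<in> sb_class X t"
    then show "sb_eval C f s = ?v"
      by (intro sb_eval_eq[OF assms(1) _ assms(2) _ assms(3)]) (auto simp: sb_class_def)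
  qed simp
  also have "\<dots> = {?v}" using sb_class_self[OF assms(3)] by blast
  finally show ?thesis by (simp add: free_lift_def)
qed

lemma free_gen_closed: "x \<in> X \<Longrightarrow> free_gen X x \<in> carrier (free_sb X)"
  by (auto simp: free_gen_def free_sb_carrier)

lemma free_lift_gen:
  "\<lbrakk>skew_brace C; f \<in> X \<rightarrow> carrier C; x \<in> X\<rbrakk> \<Longrightarrow> free_lift C f (free_gen X x) = f x"
  by (simp add: free_gen_def free_lift_class)

lemma free_lift_hom:
  assumes "skew_brace C" "f \<in> X \<rightarrow> carrier C"
  shows "free_lift C f \<in> sb_hom (free_sb X) C"
proof -
  have "sb_eval C f t \<in> carrier C" if "set_sbterm t \<subseteq> X" for t
    by (rule sb_eval_closed[OF assms(1)]) (use assms(2) that in auto)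
  then show ?thesis
    by (auto simp: sb_hom_def hom_def free_sb_carrier free_sb_add free_sb_mult
        free_lift_class[OF assms])
qed

lemma free_sb_hom_unique:
  assumes C: "skew_brace C" and h: "h \<in> sb_hom (free_sb X) C" and k: "k \<in> sb_hom (free_sb X) C"
    and eq: "\<And>x. x \<in> X \<Longrightarrow> h (free_gen X x) = k (free_gen X x)"
    and c: "c \<in> carrier (free_sb X)"
  shows "h c = k c"
proof -
  interpret C: skew_brace C by fact
  have ev: "g (sb_class X t) = sb_eval C (\<lambda>x. g (free_gen X x)) t"
    if g: "g \<in> sb_hom (free_sb X) C" and t: "set_sbterm t \<subseteq> X" for g t
  proof -
    interpret a: group_hom "add_monoid (free_sb X)" "add_monoid C" g
      using g C.add_group free_sb_add_group
      by (auto simp: group_hom_def group_hom_axioms_def sb_hom_def)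
    interpret m: group_hom "free_sb X" C g
      using g C.circ_group free_sb_circ_group
      by (auto simp: group_hom_def group_hom_axioms_def sb_hom_def)
    have cl: "sb_class X s \<in> carrier (free_sb X)" if "set_sbterm s \<subseteq> X" for s
      using that by (auto simp: free_sb_carrier)
    show ?thesis using t
    proof (induction t)
      case (Neg t)
      then show ?case using a.hom_inv[of "sb_class X t"] cl[of t] free_sb_neg[of t X]
        by (simp add: a_inv_def)
    next
      case (Add s t)
      then show ?case using a.hom_mult[of "sb_class X s" "sb_class X t"] cl free_sb_add[of s X t]
        by simp
    next
      case (Inv t)
      then show ?case using m.hom_inv[of "sb_class X t"] cl[of t] free_sb_inv[of t X] by simp
    next
      case (Circ s t)
      then show ?case using m.hom_mult[of "sb_class X s" "sb_class X t"] cl free_sb_mult[of s X t]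
        by simp
    next
      case Zero
      then show ?case using a.hom_one by (simp add: free_sb_zero)
    next
      case One
      then show ?case using m.hom_one by (simp add: free_sb_one)
    qed (simp add: free_gen_def)
  qed
  obtain t where t: "c = sb_class X t" "set_sbterm t \<subseteq> X" using c by (auto simp: free_sb_carrier)
  have "sb_eval C (\<lambda>x. h (free_gen X x)) t = sb_eval C (\<lambda>x. k (free_gen X x)) t"
    using t eq by (intro sb_eval_cong) auto
  then show ?thesis using t ev h k by simp
qed

lemma sb_hom_comp: "\<lbrakk>g \<in> sb_hom A B; h \<in> sb_hom B C\<rbrakk> \<Longrightarrow> h \<circ> g \<in> sb_hom A C"
  by (auto simp: sb_hom_def intro: hom_compose)

lemma sb_hom_id: "id \<in> sb_hom A A"
  by (auto simp: sb_hom_def hom_def)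

lemma sb_hom_closed: "\<lbrakk>h \<in> sb_hom A B; x \<in> carrier A\<rbrakk> \<Longrightarrow> h x \<in> carrier B"
  by (auto simp: sb_hom_def hom_def)

lemma is_free_on_free_sb: "is_free_on (free_sb X) (free_gen X ` X)"
proof -
  let ?P = "free_sb X" and ?Y = "free_gen X ` X"
  let ?h = "free_lift ?P (\<lambda>x. x)" and ?k = "free_lift (free_sb ?Y) (\<lambda>x. free_gen ?Y (free_gen X x))"
  note sb = skew_brace_free_sb
  have m1: "(\<lambda>x. x) \<in> ?Y \<rightarrow> carrier ?P"
    and m2: "(\<lambda>x. free_gen ?Y (free_gen X x)) \<in> X \<rightarrow> carrier (free_sb ?Y)"
    by (auto intro: free_gen_closed)
  have h: "?h \<in> sb_hom (free_sb ?Y) ?P" and k: "?k \<in> sb_hom ?P (free_sb ?Y)"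
    using free_lift_hom[OF sb m1] free_lift_hom[OF sb m2] by auto
  have "(?h \<circ> ?k) c = id c" if "c \<in> carrier ?P" for c
    by (rule free_sb_hom_unique[OF sb sb_hom_comp[OF k h] sb_hom_id _ that])
      (simp add: free_lift_gen[OF sb m2] free_lift_gen[OF sb m1])
  moreover have "(?k \<circ> ?h) c = id c" if "c \<in> carrier (free_sb ?Y)" for c
    by (rule free_sb_hom_unique[OF sb sb_hom_comp[OF h k] sb_hom_id _ that])
      (auto simp: free_lift_gen[OF sb m2] free_lift_gen[OF sb m1])
  ultimately have "bij_betw ?h (carrier (free_sb ?Y)) (carrier ?P)"
    using h k by (intro bij_betw_byWitness[where f' = ?k]) (auto intro: sb_hom_closed)
  then show ?thesis by (auto simp: is_free_on_def intro: free_gen_closed)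
qed

lemma free_presentation_canonical:
  assumes "skew_brace B"
  shows "free_presentation (free_sb (carrier B)) B (free_lift B (\<lambda>x. x))"
proof -
  have m: "(\<lambda>x. x) \<in> carrier B \<rightarrow> carrier B" by auto
  note h = free_lift_hom[OF assms m]
  have "b \<in> free_lift B (\<lambda>x. x) ` carrier (free_sb (carrier B))" if "b \<in> carrier B" for b
    using free_lift_gen[OF assms m that] free_gen_closed[OF that] by (metis imageI)
  then show ?thesis
    using h is_free_on_free_sb skew_brace_free_sb
    by (auto simp: free_presentation_def intro: sb_hom_closed)
qed

end

(*
  Write [K,P] for the relative commutator of the kernel K of p : P -> B. The key fact is that
  star a b modulo [K,P] depends only on p a and p b. Hence two homomorphisms into P that agree
  after p agree modulo [K,P] on star_ideal, and K commutes with star_ideal P modulo [K,P].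

  Invariance: lifts between two free presentations are mutually inverse modulo [K,P].

  Homology: let X_n = G^(n+1)(B). A class of F(X_1) that is a cycle has a representative u whose
  faces d_0 u, d_1 u both lie in star_ideal X_0, and u |-> - d_0 u + d_1 u modulo [K,X_0] is a
  homomorphism onto the Hopf quotient. Asphericity of X identifies its kernel with the
  representatives of boundaries; this uses that [K,X_0] = d_1 (ker d_0 \<inter> star_ideal X_1).
*)
theory Submission
  imports Defs
begin

section \<open>Skew braces and their homomorphisms\<close>

text \<open>A star absorbs kernel elements in two different ways: \<open>star_add\<close> expands a
  sum in the second argument, \<open>star_circ\<close> a circle product in the first. Both
  corrections are available because the two groups share their neutral element, so a homomorphism
  has one kernel for both operations. Two obstacles shape the homology part. Addition is not
  commutative, so the difference of two faces need not be additive; on representatives of cycles it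
  is additive modulo \<open>N\<close>, since reordering only moves an element of the kernel past one
  of the star ideal. Moreover, the reflector does not preserve kernels: a normalised chain of
  \<open>F(X)\<close> has a representative whose faces lie in star ideals, whereas exactness of
  \<open>X\<close> asks for faces equal to zero. The gap is closed by subtracting elements of star
  ideals, which does not change the class; suitable ones exist because surjections carry star ideals
  onto star ideals and because of \<open>N_lift\<close>.\<close>

sublocale skew_brace \<subseteq> add: group "add_monoid A"
  rewrites "carrier (add_monoid A) = carrier A"
    and "mult (add_monoid A) = add A"
    and "one (add_monoid A) = zero A"
    and "m_inv (add_monoid A) = a_inv A"
  by (rule add_group) (auto simp: a_inv_def)

sublocale skew_brace \<subseteq> circ: group A
  by (rule circ_group)

context skew_brace
begin

lemma add_neg_cancel:
  assumes "x \<in> carrier A" "y \<in> carrier A"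
  shows "x \<oplus> (\<ominus> x \<oplus> y) = y" "\<ominus> x \<oplus> (x \<oplus> y) = y"
  using assms by (simp_all flip: add.m_assoc)

lemmas add_word = add.m_assoc add.inv_mult_group add_neg_cancel a_minus_def

lemma subgroup_add_closed:
  assumes "subgroup H (add_monoid A)"
  shows "\<lbrakk>x \<in> H; y \<in> H\<rbrakk> \<Longrightarrow> x \<oplus> y \<in> H" "x \<in> H \<Longrightarrow> \<ominus> x \<in> H" "\<zero> \<in> H"
  using subgroup.m_closed[OF assms] subgroup.m_inv_closed[OF assms] subgroup.one_closed[OF assms]
  by (simp_all add: a_inv_def)

lemma circ_zero: assumes "a \<in> carrier A" shows "a \<otimes> \<zero> = a"
proof -
  have "a \<otimes> \<zero> = (a \<otimes> \<zero> \<oplus> \<ominus> a) \<oplus> (a \<otimes> \<zero>)"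
    using brace[of a \<zero> \<zero>] assms by (simp add: a_minus_def)
  then have "\<zero> = \<ominus> a \<oplus> (a \<otimes> \<zero>)"
    using assms by (simp add: add.m_assoc)
  then show ?thesis using assms by (metis add.inv_equality add.inv_inv add.inv_closed circ.m_closed add.one_closed)
qed

text \<open>A common neutral element gives a homomorphism the same kernel for both operations;
  \<open>cls_star_cong\<close> divides with respect to \<open>\<otimes>\<close> and still lands in
  the additive kernel.\<close>

lemma one_eq_zero: "\<one> = \<zero>"
  using circ_zero[of \<one>] by simp

lemma zero_circ: "a \<in> carrier A \<Longrightarrow> \<zero> \<otimes> a = a"
  using circ.l_one by (simp add: one_eq_zero)

lemma star_closed [simp]: "\<lbrakk>a \<in> carrier A; b \<in> carrier A\<rbrakk> \<Longrightarrow> star A a b \<in> carrier A"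
  by (simp add: star_def a_minus_def)

lemma star_zero: assumes "a \<in> carrier A" shows "star A a \<zero> = \<zero>" "star A \<zero> a = \<zero>"
  using assms by (simp_all add: star_def circ_zero zero_circ a_minus_def)

lemma circ_eq:
  assumes "a \<in> carrier A" "b \<in> carrier A"
  shows "a \<otimes> b = a \<oplus> (star A a b \<oplus> b)"
  using assms by (simp add: star_def add_word)

lemma star_add:
  assumes "a \<in> carrier A" "b \<in> carrier A" "c \<in> carrier A"
  shows "star A a (b \<oplus> c) = star A a b \<oplus> ((b \<oplus> star A a c) \<ominus> b)"
  using assms by (simp add: star_def brace add_word)

text \<open>Associativity of \<open>\<otimes>\<close> makes the circle product, not the sum, expand
  in the first argument. Every summand other than \<open>star A a b\<close> involves
  \<open>star A k b\<close>, so for \<open>k\<close> in a kernel these summands vanish modulo the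
  commutator.\<close>

lemma star_circ:
  assumes "a \<in> carrier A" "k \<in> carrier A" "b \<in> carrier A"
  shows "star A (a \<otimes> k) b = star A a (star A k b) \<oplus> star A k b \<oplus> star A a b"
proof -
  have "(a \<otimes> k) \<otimes> b = a \<otimes> (k \<oplus> (star A k b \<oplus> b))"
    using assms by (simp add: circ.m_assoc circ_eq[of k b])
  also have "\<dots> = (a \<otimes> k \<ominus> a) \<oplus> (a \<otimes> (star A k b \<oplus> b))"
    using assms by (simp add: brace)
  also have "a \<otimes> (star A k b \<oplus> b) = a \<oplus> (star A a (star A k b \<oplus> b) \<oplus> (star A k b \<oplus> b))"
    using assms by (intro circ_eq) auto
  finally show ?thesis
    using assms by (simp add: star_def[of A "a \<otimes> k"] star_add add_word)
qed

text \<open>This is \<open>star_add\<close> solved for the conjugate: conjugating a star costs only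
  stars with the same first argument. Normality of the star ideal and its commutation with the
  kernel both rest on it.\<close>

lemma conj_star:
  assumes "a \<in> carrier A" "b \<in> carrier A" "c \<in> carrier A"
  shows "(b \<oplus> star A a c) \<ominus> b = \<ominus> star A a b \<oplus> star A a (b \<oplus> c)"
  using assms by (simp add: star_add add_word)

lemma generate_conj_closed:
  assumes S: "S \<subseteq> carrier A"
    and c: "\<And>x s. \<lbrakk>x \<in> carrier A; s \<in> S\<rbrakk> \<Longrightarrow> (x \<oplus> s) \<ominus> x \<in> generate (add_monoid A) S"
  shows "generate (add_monoid A) S \<lhd> add_monoid A"
proof -
  let ?N = "generate (add_monoid A) S"
  have sub: "subgroup ?N (add_monoid A)" using S by (intro add.generate_is_subgroup) auto
  then have N: "?N \<subseteq> carrier A" using subgroup.subset by fastforce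
  have "(x \<oplus> h) \<oplus> \<ominus> x \<in> ?N" if x: "x \<in> carrier A" and h: "h \<in> ?N" for x h
    using h
  proof induction
    case one
    then show ?case using x generate.one[of "add_monoid A" S] by simp
  next
    case (incl h)
    then show ?case using c[OF x] by (simp add: a_minus_def)
  next
    case (inv h)
    then have "\<ominus> ((x \<oplus> h) \<ominus> x) \<in> ?N"
      by (intro subgroup_add_closed[OF sub] c[OF x])
    moreover have "\<ominus> ((x \<oplus> h) \<ominus> x) = (x \<oplus> \<ominus> h) \<oplus> \<ominus> x"
      using x inv S by (auto simp: add_word subset_iff)
    ultimately show ?case by (simp flip: a_inv_def)
  next
    case (eng g h)
    then have cl: "g \<in> carrier A" "h \<in> carrier A" using N by auto
    have "((x \<oplus> g) \<oplus> \<ominus> x) \<oplus> ((x \<oplus> h) \<oplus> \<ominus> x) \<in> ?N"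
      by (intro subgroup_add_closed[OF sub] eng.IH)
    then show ?case using x cl by (simp add: add_word)
  qed
  then show ?thesis using sub by (simp add: add.normal_inv_iff)
qed

lemma comm_Grp_memI:
  assumes "a \<in> I" "b \<in> carrier A"
  shows "star A a b \<in> comm_Grp A I" "star A b a \<in> comm_Grp A I"
    "c \<in> carrier A \<Longrightarrow> (c \<oplus> star A b a) \<ominus> c \<in> comm_Grp A I"
proof -
  note mem = generate.incl[OF UN_I[OF assms(1) UN_I[OF assms(2) UN_I]]]
  show "star A a b \<in> comm_Grp A I" "star A b a \<in> comm_Grp A I"
    unfolding comm_Grp_def by (rule mem[OF assms(2)], simp)+
  show "(c \<oplus> star A b a) \<ominus> c \<in> comm_Grp A I" if "c \<in> carrier A"
    unfolding comm_Grp_def by (rule mem[OF that]) simp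
qed

text \<open>Since \<open>conj_star\<close> keeps the first argument, it covers the conjugates of
  \<open>star A a b\<close> with \<open>a \<in> I\<close>. It gives nothing similar for
  \<open>star A b a\<close>; its conjugates by \<open>c\<close> are generators by definition, and
  conjugating once more by \<open>x\<close> replaces \<open>c\<close> by
  \<open>x \<oplus> c\<close>.\<close>

lemma comm_Grp_normal:
  assumes I: "I \<subseteq> carrier A"
  shows "comm_Grp A I \<lhd> add_monoid A"
proof -
  define S where "S = (\<Union>a\<in>I. \<Union>b\<in>carrier A. \<Union>c\<in>carrier A.
     {star A a b, star A b a, (c \<oplus> star A b a) \<ominus> c})"
  have N: "comm_Grp A I = generate (add_monoid A) S" by (simp only: S_def comm_Grp_def)
  have S: "S \<subseteq> carrier A" using I by (auto simp: S_def a_minus_def)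
  then have sub: "subgroup (comm_Grp A I) (add_monoid A)"
    unfolding N by (intro add.generate_is_subgroup) simp
  have "generate (add_monoid A) S \<lhd> add_monoid A"
  proof (rule generate_conj_closed[OF S])
    fix x s assume x: "x \<in> carrier A" and "s \<in> S"
    then obtain a b c where abc: "a \<in> I" "b \<in> carrier A" "c \<in> carrier A"
      and s: "s = star A a b \<or> s = star A b a \<or> s = (c \<oplus> star A b a) \<ominus> c"
      unfolding S_def by blast
    have a: "a \<in> carrier A" using I abc by blast
    note mem = comm_Grp_memI[OF abc(1)]
    have "\<ominus> star A a x \<oplus> star A a (x \<oplus> b) \<in> comm_Grp A I"
      using x abc by (intro subgroup_add_closed[OF sub] mem add.m_closed)
    then have "(x \<oplus> star A a b) \<ominus> x \<in> comm_Grp A I"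
      by (simp only: conj_star[OF a x abc(2)])
    moreover have "((x \<oplus> c) \<oplus> star A b a) \<ominus> (x \<oplus> c) \<in> comm_Grp A I"
      by (intro mem abc x add.m_closed)
    then have "(x \<oplus> ((c \<oplus> star A b a) \<ominus> c)) \<ominus> x \<in> comm_Grp A I"
      using x a abc by (simp add: add_word)
    ultimately show "(x \<oplus> s) \<ominus> x \<in> generate (add_monoid A) S"
      unfolding N[symmetric] using s mem(3)[OF abc(2) x] by blast
  qed
  then show ?thesis by (simp only: N)
qed

lemma comm_Grp_subset: "I \<subseteq> carrier A \<Longrightarrow> comm_Grp A I \<subseteq> carrier A"
  using subgroup.subset[OF normal_imp_subgroup[OF comm_Grp_normal]] by simp

lemma comm_Grp_least:
  assumes "subgroup H (add_monoid A)"
    and "\<And>a b. \<lbrakk>a \<in> I; b \<in> carrier A\<rbrakk> \<Longrightarrow> star A a b \<in> H"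
    and "\<And>a b. \<lbrakk>a \<in> I; b \<in> carrier A\<rbrakk> \<Longrightarrow> star A b a \<in> H"
    and "\<And>a b c. \<lbrakk>a \<in> I; b \<in> carrier A; c \<in> carrier A\<rbrakk> \<Longrightarrow> (c \<oplus> star A b a) \<ominus> c \<in> H"
  shows "comm_Grp A I \<subseteq> H"
  unfolding comm_Grp_def
  by (rule add.generate_subgroup_incl[OF _ assms(1)])
    (intro UN_least insert_subsetI assms(2-) empty_subsetI; assumption)

lemma comm_Grp_mono: "I \<subseteq> J \<Longrightarrow> comm_Grp A I \<subseteq> comm_Grp A J"
  unfolding comm_Grp_def by (intro add.mono_generate UN_mono subset_refl) assumption

text \<open>By \<open>conj_star\<close> the conjugated generators of
  \<open>comm_Grp A (carrier A)\<close> are already combinations of stars. The equality hands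
  normality of the commutator over to \<open>star_ideal\<close>.\<close>

lemma star_ideal_eq: "star_ideal A = comm_Grp A (carrier A)"
proof
  let ?N = "star_ideal A"
  have sub: "subgroup ?N (add_monoid A)"
    unfolding star_ideal_def by (rule add.generate_is_subgroup) auto
  have star: "star A a b \<in> ?N" if "a \<in> carrier A" "b \<in> carrier A" for a b
    unfolding star_ideal_def by (rule generate.incl) (use that in blast)
  have conj: "(c \<oplus> star A b a) \<ominus> c \<in> ?N"
    if "a \<in> carrier A" "b \<in> carrier A" "c \<in> carrier A" for a b c
    unfolding conj_star[OF that(2,3,1)]
    using that by (intro subgroup_add_closed[OF sub] star add.m_closed)
  show "comm_Grp A (carrier A) \<subseteq> ?N"
    by (rule comm_Grp_least[OF sub]) (rule star conj; assumption)+
  have "generate (add_monoid A) (\<Union>a\<in>carrier A. \<Union>b\<in>carrier A. {star A a b})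
    \<subseteq> comm_Grp A (carrier A)"
    by (rule add.generate_subgroup_incl[OF _ normal_imp_subgroup[OF comm_Grp_normal]])
      (auto intro: comm_Grp_memI)
  then show "?N \<subseteq> comm_Grp A (carrier A)" by (simp add: star_ideal_def)
qed

lemma star_ideal_normal: "star_ideal A \<lhd> add_monoid A"
  by (simp add: star_ideal_eq comm_Grp_normal)

lemma star_ideal_subset: "star_ideal A \<subseteq> carrier A"
  by (simp add: star_ideal_eq comm_Grp_subset)

end

locale skew_brace_hom = P: skew_brace P + B: skew_brace B
  for P :: "('p, 'm) ring_scheme" and B :: "('b, 'n) ring_scheme" and p +
  assumes hom: "p \<in> sb_hom P B"

sublocale skew_brace_hom \<subseteq> add: group_hom "add_monoid P" "add_monoid B" p
  rewrites "carrier (add_monoid P) = carrier P"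
    and "mult (add_monoid P) = add P"
    and "one (add_monoid P) = zero P"
    and "m_inv (add_monoid P) = a_inv P"
    and "carrier (add_monoid B) = carrier B"
    and "mult (add_monoid B) = add B"
    and "one (add_monoid B) = zero B"
    and "m_inv (add_monoid B) = a_inv B"
  using hom P.add_group B.add_group
  by (auto simp: group_hom_def group_hom_axioms_def sb_hom_def a_inv_def)

sublocale skew_brace_hom \<subseteq> circ: group_hom P B p
  using hom P.circ_group B.circ_group
  by (auto simp: group_hom_def group_hom_axioms_def sb_hom_def)

context skew_brace_hom
begin

lemma hom_star:
  "\<lbrakk>a \<in> carrier P; b \<in> carrier P\<rbrakk> \<Longrightarrow> p (star P a b) = star B (p a) (p b)"
  by (simp add: star_def a_minus_def)

lemma image_star_ideal_eq:
  "p ` star_ideal P =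
    generate (add_monoid B) (\<Union>a\<in>carrier P. \<Union>b\<in>carrier P. {star B (p a) (p b)})"
proof -
  have "p ` star_ideal P = generate (add_monoid B) (p ` (\<Union>a\<in>carrier P. \<Union>b\<in>carrier P. {star P a b}))"
    unfolding star_ideal_def by (rule add.generate_img[symmetric]) auto
  also have "p ` (\<Union>a\<in>carrier P. \<Union>b\<in>carrier P. {star P a b}) =
      (\<Union>a\<in>carrier P. \<Union>b\<in>carrier P. {p (star P a b)})"
    by blast
  also have "\<dots> = (\<Union>a\<in>carrier P. \<Union>b\<in>carrier P. {star B (p a) (p b)})"
    by (simp add: hom_star cong: SUP_cong_simp)
  finally show ?thesis .
qed

lemma image_star_ideal: "p ` star_ideal P \<subseteq> star_ideal B"
  unfolding image_star_ideal_eq star_ideal_def[of B]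
  by (rule B.add.mono_generate) (blast intro: add.hom_closed)

text \<open>With equality instead of inclusion, an element of the star ideal of \<open>B\<close> has
  a preimage inside the star ideal of \<open>P\<close>; subtracting such preimages corrects
  representatives without changing their class.\<close>

lemma image_star_ideal_surj:
  assumes "p ` carrier P = carrier B"
  shows "p ` star_ideal P = star_ideal B"
proof -
  have "(\<Union>a\<in>carrier B. \<Union>b\<in>carrier B. {star B a b}) =
      (\<Union>a\<in>carrier P. \<Union>b\<in>carrier P. {star B (p a) (p b)})"
    unfolding assms[symmetric] by simp
  then show ?thesis by (simp only: image_star_ideal_eq star_ideal_def[of B])
qed

section \<open>Stars modulo the relative commutator of a kernel\<close>

abbreviation "K \<equiv> sb_kernel P B p"
abbreviation "N \<equiv> comm_Grp P K"

lemma K_iff: "x \<in> K \<longleftrightarrow> x \<in> carrier P \<and> p x = \<zero>\<^bsub>B\<^esub>"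
  by (simp add: sb_kernel_def kernel_def)

lemma K_subset: "K \<subseteq> carrier P" by (auto simp: K_iff)

lemma K_subgroup: "subgroup K (add_monoid P)"
  using add.subgroup_kernel by (simp add: sb_kernel_def)

lemma N_normal: "N \<lhd> add_monoid P" by (rule P.comm_Grp_normal[OF K_subset])

lemma N_subgroup: "subgroup N (add_monoid P)" using N_normal normal_imp_subgroup by blast

lemma N_subset_K: "N \<subseteq> K"
  by (rule P.comm_Grp_least[OF K_subgroup]) (auto simp: K_iff hom_star B.star_zero a_minus_def)

lemma N_subset_star_ideal: "N \<subseteq> star_ideal P"
  unfolding P.star_ideal_eq by (rule P.comm_Grp_mono[OF K_subset])

sublocale N: normal N "add_monoid P"
  rewrites "carrier (add_monoid P) = carrier P"
    and "mult (add_monoid P) = add P"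
    and "one (add_monoid P) = zero P"
    and "m_inv (add_monoid P) = a_inv P"
  by (rule N_normal) (auto simp: a_inv_def)

abbreviation "cls \<equiv> r_coset (add_monoid P) N"

sublocale cls: group_hom "add_monoid P" "add_monoid P Mod N" cls
  rewrites "carrier (add_monoid P) = carrier P"
    and "mult (add_monoid P) = add P"
    and "one (add_monoid P) = zero P"
    and "m_inv (add_monoid P) = a_inv P"
  using N.r_coset_hom_Mod N.factorgroup_is_group P.add_group
  by (auto simp: group_hom_def group_hom_axioms_def a_inv_def)

lemma cls_N: "x \<in> N \<Longrightarrow> cls x = \<one>\<^bsub>add_monoid P Mod N\<^esub>"
  using N.rcos_const by simp

lemma cls_eq_one_iff: "x \<in> carrier P \<Longrightarrow> cls x = \<one>\<^bsub>add_monoid P Mod N\<^esub> \<longleftrightarrow> x \<in> N"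
  using P.add.coset_join1[of N x] N_subgroup by (auto simp: cls_N)

lemma cls_star_add:
  assumes "a \<in> carrier P" "b \<in> carrier P" "l \<in> K"
  shows "cls (star P a (b \<oplus>\<^bsub>P\<^esub> l)) = cls (star P a b)"
proof -
  have l: "l \<in> carrier P" using assms K_subset by blast
  have "cls ((b \<oplus>\<^bsub>P\<^esub> star P a l) \<ominus>\<^bsub>P\<^esub> b) = \<one>\<^bsub>add_monoid P Mod N\<^esub>"
    using assms by (intro cls_N P.comm_Grp_memI)
  then show ?thesis
    using assms l cls.hom_closed[of "star P a b"]
    by (simp add: P.star_add a_minus_def del: one_FactGroup mult_FactGroup)
qed

lemma cls_star_circ:
  assumes "a \<in> carrier P" "b \<in> carrier P" "k \<in> K"
  shows "cls (star P (a \<otimes>\<^bsub>P\<^esub> k) b) = cls (star P a b)"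
proof -
  have k: "k \<in> carrier P" using assms K_subset by blast
  have kb: "star P k b \<in> N" using assms by (intro P.comm_Grp_memI)
  \<comment> \<open>As \<open>N \<subseteq> K\<close>, the element \<open>star P k b\<close> may
    itself serve as the kernel entry of a generator.\<close>
  then have "star P a (star P k b) \<in> N"
    using assms N_subset_K by (intro P.comm_Grp_memI) auto
  then show ?thesis
    using assms k kb cls.hom_closed[of "star P a b"]
    by (simp add: P.star_circ cls_N del: one_FactGroup mult_FactGroup)
qed

text \<open>The first arguments differ by a circle factor in \<open>K\<close>, the second ones by a
  summand in \<open>K\<close>. These are the directions in which \<open>star_circ\<close> and
  \<open>star_add\<close> expand, and every correction term then lies in \<open>N\<close>.\<close>

lemma cls_star_cong:
  assumes "a \<in> carrier P" "b \<in> carrier P" "a' \<in> carrier P" "b' \<in> carrier P"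
    and "p a = p a'" "p b = p b'"
  shows "cls (star P a b) = cls (star P a' b')"
proof -
  let ?k = "inv\<^bsub>P\<^esub> a \<otimes>\<^bsub>P\<^esub> a'" and ?l = "\<ominus>\<^bsub>P\<^esub> b \<oplus>\<^bsub>P\<^esub> b'"
  have "?k \<in> K" "?l \<in> K"
    using assms by (simp_all add: K_iff B.one_eq_zero[symmetric])
  then have "cls (star P (a \<otimes>\<^bsub>P\<^esub> ?k) (b \<oplus>\<^bsub>P\<^esub> ?l)) = cls (star P a b)"
    using assms by (simp only: cls_star_add cls_star_circ P.circ.m_closed P.circ.inv_closed)
  moreover have "a \<otimes>\<^bsub>P\<^esub> ?k = a'"
    using assms by (simp flip: P.circ.m_assoc)
  moreover have "b \<oplus>\<^bsub>P\<^esub> ?l = b'"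
    using assms by (simp add: P.add_word)
  ultimately show ?thesis by simp
qed

text \<open>For a single star, \<open>conj_star\<close> turns the conjugate into
  \<open>- star P a k + star P a (k + c)\<close>: the first term is in \<open>N\<close>, the second
  is congruent to \<open>star P a c\<close> because \<open>p\<close> kills \<open>k\<close>.
  Conjugation and \<open>cls\<close> are additive, so the generated subgroup follows.\<close>

lemma cls_conj_star_ideal:
  assumes k: "k \<in> K" and w: "w \<in> star_ideal P"
  shows "cls ((k \<oplus>\<^bsub>P\<^esub> w) \<ominus>\<^bsub>P\<^esub> k) = cls w"
proof -
  have k': "k \<in> carrier P" using k K_subset by blast
  let ?c = "\<lambda>w. (k \<oplus>\<^bsub>P\<^esub> w) \<ominus>\<^bsub>P\<^esub> k"
  have cl: "?c w \<in> carrier P" if "w \<in> carrier P" for w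
    using that k' by (simp add: a_minus_def)
  have gen: "cls (?c w) = cls w" if ac: "a \<in> carrier P" "c \<in> carrier P" "w = star P a c" for a c w
  proof -
    have "star P a k \<in> N" using k ac by (intro P.comm_Grp_memI)
    moreover have "cls (star P a (k \<oplus>\<^bsub>P\<^esub> c)) = cls (star P a c)"
      using ac k k' by (intro cls_star_cong) (simp_all add: K_iff)
    ultimately show ?thesis
      using ac k' cls.hom_closed[of "star P a c"]
      by (simp add: P.conj_star cls_N del: one_FactGroup mult_FactGroup)
  qed
  have "w \<in> carrier P \<and> cls (?c w) = cls w"
    using w unfolding star_ideal_def
  proof induction
    case one
    then show ?case using k' by (simp add: a_minus_def)
  next
    case (incl w)
    then show ?case using gen by (auto simp del: one_FactGroup mult_FactGroup)
  next
    case (inv w)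
    then have "w \<in> carrier P" "cls (?c w) = cls w" using gen by auto
    moreover have "?c (\<ominus>\<^bsub>P\<^esub> w) = \<ominus>\<^bsub>P\<^esub> (?c w)"
      using k' \<open>w \<in> carrier P\<close> by (simp add: P.add_word)
    ultimately show ?case using cl[of w] by (simp flip: a_inv_def)
  next
    case (eng v w)
    then have v: "v \<in> carrier P" "w \<in> carrier P" by auto
    have "?c (v \<oplus>\<^bsub>P\<^esub> w) = ?c v \<oplus>\<^bsub>P\<^esub> ?c w"
      using k' v by (simp add: P.add_word)
    then have "cls (?c (v \<oplus>\<^bsub>P\<^esub> w)) = cls (v \<oplus>\<^bsub>P\<^esub> w)"
      using eng.IH v cl by (simp del: mult_FactGroup)
    then show ?case using v by simp
  qed
  then show ?thesis by simp
qed

text \<open>After composition with \<open>cls\<close>, both maps are homomorphisms, and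
  \<open>cls_star_cong\<close> makes them agree on every star. This is applied to the two faces of
  \<open>X 1\<close> and to round trips of lifts compared with the identity.\<close>

lemma hom_cls_eq:
  assumes Q: "skew_brace Q" and f: "f \<in> sb_hom Q P" and g: "g \<in> sb_hom Q P"
    and eq: "\<And>x. x \<in> carrier Q \<Longrightarrow> p (f x) = p (g x)"
    and w: "w \<in> star_ideal Q"
  shows "cls (f w) = cls (g w)"
proof -
  interpret f: skew_brace_hom Q P f using Q f P.skew_brace_axioms
    by (intro skew_brace_hom.intro skew_brace_hom_axioms.intro)
  interpret g: skew_brace_hom Q P g using Q g P.skew_brace_axioms
    by (intro skew_brace_hom.intro skew_brace_hom_axioms.intro)
  have gen: "cls (f (star Q a b)) = cls (g (star Q a b))" if "a \<in> carrier Q" "b \<in> carrier Q" for a b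
    using that eq by (simp only: f.hom_star g.hom_star) (intro cls_star_cong; simp)
  have "w \<in> carrier Q \<and> cls (f w) = cls (g w)"
    using w unfolding star_ideal_def
  proof induction
    case one
    then show ?case by simp
  next
    case (incl w)
    then show ?case using gen by auto
  next
    case (inv w)
    then have "w \<in> carrier Q" "cls (f w) = cls (g w)" using gen by auto
    then show ?case by (simp flip: a_inv_def)
  next
    case (eng v w)
    then show ?case by (simp del: mult_FactGroup)
  qed
  then show ?thesis by simp
qed

end

section \<open>Isomorphisms read off from a common group of representatives\<close>

lemma iso_of_same_kernel:
  assumes f: "group_hom U G f" and g: "group_hom U H g"
    and surj: "f ` carrier U = carrier G" "g ` carrier U = carrier H"
    and ker: "kernel U G f = kernel U H g"
  shows "G \<cong> H"
proof -
  interpret f: group_hom U G f by fact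
  interpret g: group_hom U H g by fact
  have "U Mod kernel U G f \<cong> G" "U Mod kernel U G f \<cong> H"
    using f.FactGroup_iso[OF surj(1)] g.FactGroup_iso[OF surj(2)] ker by auto
  moreover have "group (U Mod kernel U G f)"
    by (rule normal.factorgroup_is_group[OF f.normal_kernel])
  ultimately show ?thesis by (meson group.iso_sym iso_trans)
qed

lemma Mod_image_kernel_iso:
  assumes q: "group_hom U Z q" and t: "group_hom U H t"
    and surj: "q ` carrier U = carrier Z" "t ` carrier U = carrier H"
    and ker: "kernel U Z q \<subseteq> kernel U H t"
  shows "Z Mod q ` kernel U H t \<cong> H"
proof -
  interpret q: group_hom U Z q by fact
  interpret t: group_hom U H t by fact
  define h where "h z = t (inv_into (carrier U) q z)" for z
  have hq: "h (q u) = t u" if u: "u \<in> carrier U" for u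
  proof -
    let ?v = "inv_into (carrier U) q (q u)"
    have v: "?v \<in> carrier U" "q ?v = q u"
      using u by (auto intro: inv_into_into f_inv_into_f)
    then have "?v \<otimes>\<^bsub>U\<^esub> inv\<^bsub>U\<^esub> u \<in> kernel U Z q"
      using u by (simp add: kernel_def)
    then have "t (?v \<otimes>\<^bsub>U\<^esub> inv\<^bsub>U\<^esub> u) = \<one>\<^bsub>H\<^esub>"
      using ker by (auto simp: kernel_def)
    then have "t ?v \<otimes>\<^bsub>H\<^esub> inv\<^bsub>H\<^esub> t u = \<one>\<^bsub>H\<^esub>"
      using u v by simp
    then have "t ?v = t u"
      using u v by (metis t.H.inv_equality t.H.inv_inv t.H.inv_closed t.hom_closed)
    then show ?thesis by (simp add: h_def)
  qed
  have Z: "z \<in> carrier Z \<longleftrightarrow> (\<exists>u\<in>carrier U. z = q u)" for z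
    using surj(1) by blast
  have "h \<in> hom Z H"
  proof (rule homI)
    show "h z \<in> carrier H" if "z \<in> carrier Z" for z
      using that by (auto simp: Z hq)
    show "h (x \<otimes>\<^bsub>Z\<^esub> y) = h x \<otimes>\<^bsub>H\<^esub> h y" if xy: "x \<in> carrier Z" "y \<in> carrier Z" for x y
    proof -
      obtain u v where "u \<in> carrier U" "v \<in> carrier U" "x = q u" "y = q v"
        using xy Z by meson
      then show ?thesis by (simp add: hq flip: q.hom_mult)
    qed
  qed
  then interpret h: group_hom Z H h
    by (unfold_locales)
  have "kernel Z H h = q ` kernel U H t"
    by (auto simp: kernel_def Z hq)
  moreover have "h ` carrier Z = carrier H"
    unfolding surj[symmetric] by (simp add: image_image hq)
  ultimately show ?thesis using h.FactGroup_iso by simp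
qed

text \<open>Cosets and their product read only the multiplication of \<open>G\<close>, so shrinking
  the carrier before or after the quotient is the same. Thus Hopf quotients and groups of cycles can
  be handled inside one big quotient, with its quotient map.\<close>

lemma FactGroup_carrier_update:
  "G\<lparr>carrier := S\<rparr> Mod N = (G Mod N)\<lparr>carrier := (\<lambda>x. N #>\<^bsub>G\<^esub> x) ` S\<rparr>"
  by (auto simp: FactGroup_def RCOSETS_def r_coset_def set_mult_def fun_eq_iff)

section \<open>Hopf quotients and maps over the base\<close>

context skew_brace_hom
begin

text \<open>The preimage of \<open>comm_Grp B J\<close> is a subgroup containing all generators of
  \<open>comm_Grp P I\<close>.\<close>

lemma image_comm_Grp:
  assumes I: "I \<subseteq> carrier P" and J: "J \<subseteq> carrier B" and IJ: "p ` I \<subseteq> J"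
  shows "p ` comm_Grp P I \<subseteq> comm_Grp B J"
proof -
  let ?H = "{x \<in> carrier P. p x \<in> comm_Grp B J}"
  note N = normal_imp_subgroup[OF B.comm_Grp_normal[OF J]]
  have "\<zero>\<^bsub>P\<^esub> \<in> ?H" using B.subgroup_add_closed[OF N] by simp
  then have sub: "subgroup ?H (add_monoid P)"
    using B.subgroup_add_closed[OF N] by (intro P.add.subgroupI) (auto simp flip: a_inv_def)
  have mem: "star P a b \<in> ?H" "star P b a \<in> ?H"
    "c \<in> carrier P \<Longrightarrow> (c \<oplus>\<^bsub>P\<^esub> star P b a) \<ominus>\<^bsub>P\<^esub> c \<in> ?H"
    if "a \<in> I" "b \<in> carrier P" for a b c
  proof -
    have a: "a \<in> carrier P" "p a \<in> J" using I IJ that by auto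
    note mem = B.comm_Grp_memI[OF a(2) add.hom_closed[OF that(2)]]
    show "star P a b \<in> ?H" "star P b a \<in> ?H"
      using mem(1,2) a that by (simp_all add: hom_star)
    show "(c \<oplus>\<^bsub>P\<^esub> star P b a) \<ominus>\<^bsub>P\<^esub> c \<in> ?H" if c: "c \<in> carrier P"
      using mem(3)[OF add.hom_closed[OF c]] a \<open>b \<in> carrier P\<close> c by (simp add: a_minus_def hom_star)
  qed
  have "comm_Grp P I \<subseteq> ?H"
    by (rule P.comm_Grp_least[OF sub]) (rule mem; assumption)+
  then show ?thesis by blast
qed

lemma K_star_ideal_subgroup: "subgroup (K \<inter> star_ideal P) (add_monoid P)"
  by (intro P.add.subgroups_Inter_pair K_subgroup normal_imp_subgroup P.star_ideal_normal)

lemma hopf_quotient_eq: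
  "hopf_quotient P K = (add_monoid P Mod N)\<lparr>carrier := cls ` (K \<inter> star_ideal P)\<rparr>"
  unfolding hopf_quotient_def P.star_ideal_eq by (rule FactGroup_carrier_update)

lemma hopf_quotient_group: "group (hopf_quotient P K)"
  unfolding hopf_quotient_def P.star_ideal_eq[symmetric]
  by (intro normal.factorgroup_is_group P.add.normal_restrict_supergroup K_star_ideal_subgroup
      N_normal le_infI N_subset_K N_subset_star_ideal)

text \<open>Additivity of \<open>t\<close> is asked for only modulo \<open>N\<close>, the form in
  which the difference of two faces satisfies it.\<close>

lemma hopf_group_hom:
  assumes U: "group U"
    and cl: "\<And>u. u \<in> carrier U \<Longrightarrow> t u \<in> K \<inter> star_ideal P"
    and mult: "\<And>u v. \<lbrakk>u \<in> carrier U; v \<in> carrier U\<rbrakk>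
      \<Longrightarrow> cls (t (u \<otimes>\<^bsub>U\<^esub> v)) = cls (t u \<oplus>\<^bsub>P\<^esub> t v)"
  shows "group_hom U (hopf_quotient P K) (\<lambda>u. cls (t u))"
proof -
  have "(\<lambda>u. cls (t u)) \<in> hom U (hopf_quotient P K)"
    unfolding hopf_quotient_eq using cl mult K_subset
    by (intro homI) (auto simp: subset_iff simp del: mult_FactGroup)
  then show ?thesis
    using U hopf_quotient_group by (simp add: group_hom_def group_hom_axioms_def)
qed

lemma hopf_kernel:
  assumes "\<And>u. u \<in> carrier U \<Longrightarrow> t u \<in> carrier P"
  shows "kernel U (hopf_quotient P K) (\<lambda>u. cls (t u)) = {u \<in> carrier U. t u \<in> N}"
  using assms cls_eq_one_iff unfolding hopf_quotient_eq by (auto simp: kernel_def)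

end

text \<open>Both quotients are images of the numerator for \<open>P\<close>, under
  \<open>p.cls\<close> and under \<open>p'.cls\<close> after \<open>f\<close>. The round trips
  \<open>f \<circ> g\<close> and \<open>g \<circ> f\<close> lie over the identity of
  \<open>B\<close>, so by \<open>hom_cls_eq\<close> they are trivial modulo the commutators on star
  ideals: the first gives surjectivity, with \<open>g w\<close> as preimage of \<open>w\<close>, the
  second gives equality of the kernels.\<close>

lemma hopf_quotient_iso:
  assumes p: "skew_brace_hom P B p" and p': "skew_brace_hom P' B p'"
    and f: "f \<in> sb_hom P P'" "\<And>x. x \<in> carrier P \<Longrightarrow> p' (f x) = p x"
    and g: "g \<in> sb_hom P' P" "\<And>x. x \<in> carrier P' \<Longrightarrow> p (g x) = p' x"
  shows "hopf_quotient P (sb_kernel P B p) \<cong> hopf_quotient P' (sb_kernel P' B p')"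
proof -
  interpret p: skew_brace_hom P B p by fact
  interpret p': skew_brace_hom P' B p' by fact
  interpret f: skew_brace_hom P P' f using f p.P.skew_brace_axioms p'.P.skew_brace_axioms
    by (intro skew_brace_hom.intro skew_brace_hom_axioms.intro)
  interpret g: skew_brace_hom P' P g using g p.P.skew_brace_axioms p'.P.skew_brace_axioms
    by (intro skew_brace_hom.intro skew_brace_hom_axioms.intro)
  have fgc: "p'.cls (f (g w)) = p'.cls w" if "w \<in> star_ideal P'" for w
    using p'.hom_cls_eq[of P' "f \<circ> g" id w] that f g sb_hom_comp[OF g(1) f(1)] sb_hom_id
      p'.P.skew_brace_axioms by auto
  have gfc: "p.cls (g (f w)) = p.cls w" if "w \<in> star_ideal P" for w
    using p.hom_cls_eq[of P "g \<circ> f" id w] that f g sb_hom_comp[OF f(1) g(1)] sb_hom_id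
      p.P.skew_brace_axioms by auto
  have fK: "f x \<in> p'.K \<inter> star_ideal P'" if "x \<in> p.K \<inter> star_ideal P" for x
    using that f.image_star_ideal by (auto simp: p.K_iff p'.K_iff f)
  have gK: "g x \<in> p.K \<inter> star_ideal P" if "x \<in> p'.K \<inter> star_ideal P'" for x
    using that g.image_star_ideal by (auto simp: p.K_iff p'.K_iff g)
  have "f ` p.K \<subseteq> p'.K" "g ` p'.K \<subseteq> p.K"
    by (auto simp: p.K_iff p'.K_iff f g)
  then have "f ` p.N \<subseteq> p'.N" "g ` p'.N \<subseteq> p.N"
    using f.image_comm_Grp[OF p.K_subset p'.K_subset] g.image_comm_Grp[OF p'.K_subset p.K_subset]
    by simp_all
  then have fN: "\<And>x. x \<in> p.N \<Longrightarrow> f x \<in> p'.N" and gN: "\<And>x. x \<in> p'.N \<Longrightarrow> g x \<in> p.N"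
    by blast+
  define U where "U = (add_monoid P)\<lparr>carrier := p.K \<inter> star_ideal P\<rparr>"
  have U: "group U"
    unfolding U_def by (rule p.P.add.subgroup_imp_group[OF p.K_star_ideal_subgroup])
  have cU: "carrier U = p.K \<inter> star_ideal P" and mU: "x \<otimes>\<^bsub>U\<^esub> y = x \<oplus>\<^bsub>P\<^esub> y" for x y
    by (simp_all add: U_def)
  show ?thesis
  proof (rule iso_of_same_kernel)
    show "group_hom U (hopf_quotient P p.K) (\<lambda>u. p.cls u)"
      by (rule p.hopf_group_hom[OF U]) (simp_all only: cU mU)
    show "group_hom U (hopf_quotient P' p'.K) (\<lambda>u. p'.cls (f u))"
      by (rule p'.hopf_group_hom[OF U]) (use fK p.K_subset in \<open>simp_all add: cU mU subset_iff\<close>)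
    show "(\<lambda>u. p.cls u) ` carrier U = carrier (hopf_quotient P p.K)"
      by (simp add: p.hopf_quotient_eq cU)
    show "(\<lambda>u. p'.cls (f u)) ` carrier U = carrier (hopf_quotient P' p'.K)"
    proof -
      have "p'.cls w \<in> (\<lambda>u. p'.cls (f u)) ` carrier U" if "w \<in> p'.K \<inter> star_ideal P'" for w
        using fgc[of w] gK[OF that] that unfolding cU by (metis IntD2 image_eqI)
      then show ?thesis using fK unfolding p'.hopf_quotient_eq cU by auto
    qed
    have "x \<in> p.N \<longleftrightarrow> f x \<in> p'.N" if x: "x \<in> p.K \<inter> star_ideal P" for x
    proof
      assume "f x \<in> p'.N"
      then have "p.cls x = \<one>\<^bsub>add_monoid P Mod p.N\<^esub>"
        using gfc[of x] x p.cls_N[OF gN] by simp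
      then show "x \<in> p.N" using x p.cls_eq_one_iff[of x] p.K_subset by blast
    qed (rule fN)
    moreover have "kernel U (hopf_quotient P p.K) (\<lambda>u. p.cls u) = {u \<in> carrier U. u \<in> p.N}"
      by (rule p.hopf_kernel) (use p.K_subset in \<open>auto simp: cU\<close>)
    moreover have "kernel U (hopf_quotient P' p'.K) (\<lambda>u. p'.cls (f u)) = {u \<in> carrier U. f u \<in> p'.N}"
      by (rule p'.hopf_kernel) (use p.K_subset in \<open>auto simp: cU\<close>)
    ultimately show "kernel U (hopf_quotient P p.K) (\<lambda>u. p.cls u) =
        kernel U (hopf_quotient P' p'.K) (\<lambda>u. p'.cls (f u))"
      unfolding cU by blast
  qed
qed

section \<open>The reflector\<close>

context skew_brace
begin

abbreviation "refl_cls \<equiv> r_coset (add_monoid A) (star_ideal A)"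

lemma reflector_group: "group (reflector A)"
  unfolding reflector_def by (rule normal.factorgroup_is_group[OF star_ideal_normal])

sublocale refl: group_hom "add_monoid A" "reflector A" refl_cls
  rewrites "carrier (add_monoid A) = carrier A"
    and "mult (add_monoid A) = add A"
    and "one (add_monoid A) = zero A"
    and "m_inv (add_monoid A) = a_inv A"
  using normal.r_coset_hom_Mod[OF star_ideal_normal] reflector_group add_group
  by (auto simp: group_hom_def group_hom_axioms_def a_inv_def reflector_def)

lemma star_ideal_subgroup: "subgroup (star_ideal A) (add_monoid A)"
  using star_ideal_normal normal_imp_subgroup by blast

lemma reflector_carrier: "carrier (reflector A) = refl_cls ` carrier A"
  by (simp add: reflector_def carrier_FactGroup)

lemma refl_cls_one_iff: "x \<in> carrier A \<Longrightarrow> refl_cls x = \<one>\<^bsub>reflector A\<^esub> \<longleftrightarrow> x \<in> star_ideal A"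
  using add.coset_join1[OF _ _ star_ideal_subgroup] add.coset_join2[OF _ star_ideal_subgroup]
  by (auto simp: reflector_def)

lemma refl_cls_one: "x \<in> star_ideal A \<Longrightarrow> refl_cls x = \<one>\<^bsub>reflector A\<^esub>"
  using refl_cls_one_iff star_ideal_subset by blast

lemma refl_cls_add:
  assumes "x \<in> carrier A" "s \<in> star_ideal A"
  shows "refl_cls (\<ominus> s \<oplus> x) = refl_cls x"
proof -
  have s: "s \<in> carrier A" using assms star_ideal_subset by blast
  have "refl_cls (\<ominus> s) = \<one>\<^bsub>reflector A\<^esub>"
    using assms by (intro refl_cls_one subgroup_add_closed[OF star_ideal_subgroup])
  then show ?thesis using assms s by simp
qed

lemma refl_cls_self: "x \<in> carrier A \<Longrightarrow> x \<in> refl_cls x"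
  using add.rcos_self[OF _ star_ideal_subgroup] by simp

end

context skew_brace_hom
begin

text \<open>The union in \<open>refl_map\<close> runs over representatives that all give the same
  coset; since there is at least one, the union is that coset.\<close>

lemma refl_map_cls:
  assumes u: "u \<in> carrier P"
  shows "refl_map B p (P.refl_cls u) = B.refl_cls (p u)"
proof -
  have "B.refl_cls (p x) = B.refl_cls (p u)" if x: "x \<in> P.refl_cls u" for x
  proof -
    obtain s where s: "s \<in> star_ideal P" "x = s \<oplus>\<^bsub>P\<^esub> u"
      using x by (auto simp: r_coset_def)
    have "s \<in> carrier P" using s P.star_ideal_subset by blast
    moreover have "B.refl_cls (p s) = \<one>\<^bsub>reflector B\<^esub>"
      using s image_star_ideal by (intro B.refl_cls_one) auto
    ultimately show ?thesis using s u by simp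
  qed
  then have "refl_map B p (P.refl_cls u) = (\<Union>x\<in>P.refl_cls u. B.refl_cls (p u))"
    unfolding refl_map_def by (rule SUP_cong[OF HOL.refl])
  moreover have "P.refl_cls u \<noteq> {}" using P.refl_cls_self[OF u] by blast
  ultimately show ?thesis by simp
qed

end

section \<open>The first two homology groups of an aspherical simplicial skew brace\<close>

text \<open>Simplicial identities and exactness are recorded in the low degrees that the first two
  homology groups see. \<open>face_face\<close> lists the identities between degrees 2 and 0,
  \<open>face_surj\<close> stands in for degeneracies, and \<open>exact0\<close>,
  \<open>exact1\<close> are exactness of the augmented Moore complex of \<open>X\<close> at degrees
  0 and 1.\<close>

locale aspherical_simplicial_skew_brace =
  fixes X :: "nat \<Rightarrow> ('x, 'm) ring_scheme" and d :: "nat \<Rightarrow> nat \<Rightarrow> 'x \<Rightarrow> 'x"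
    and B :: "('b, 'n) ring_scheme" and p :: "'x \<Rightarrow> 'b"
  assumes skew_brace_X: "skew_brace (X n)"
    and skew_brace_B: "skew_brace B"
    and face_hom: "i \<le> Suc n \<Longrightarrow> d (Suc n) i \<in> sb_hom (X (Suc n)) (X n)"
    and aug_hom: "p \<in> sb_hom (X 0) B"
    and aug_face: "x \<in> carrier (X 1) \<Longrightarrow> p (d 1 0 x) = p (d 1 1 x)"
    and face_face: "x \<in> carrier (X 2) \<Longrightarrow> d 1 0 (d 2 1 x) = d 1 0 (d 2 0 x)"
      "x \<in> carrier (X 2) \<Longrightarrow> d 1 0 (d 2 2 x) = d 1 1 (d 2 0 x)"
      "x \<in> carrier (X 2) \<Longrightarrow> d 1 1 (d 2 2 x) = d 1 1 (d 2 1 x)"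
    and aug_surj: "p ` carrier (X 0) = carrier B"
    and face_surj: "d 1 0 ` carrier (X 1) = carrier (X 0)" "d 1 1 ` carrier (X 1) = carrier (X 0)"
    and exact0: "\<lbrakk>k \<in> carrier (X 0); p k = \<zero>\<^bsub>B\<^esub>\<rbrakk>
      \<Longrightarrow> \<exists>u\<in>carrier (X 1). d 1 0 u = \<zero>\<^bsub>X 0\<^esub> \<and> d 1 1 u = k"
    and exact1: "\<lbrakk>u \<in> carrier (X 1); d 1 0 u = \<zero>\<^bsub>X 0\<^esub>; d 1 1 u = \<zero>\<^bsub>X 0\<^esub>\<rbrakk>
      \<Longrightarrow> \<exists>w\<in>carrier (X 2). d 2 0 w = \<zero>\<^bsub>X 1\<^esub> \<and> d 2 1 w = \<zero>\<^bsub>X 1\<^esub> \<and> d 2 2 w = u"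
begin

\<comment> \<open>otherwise the simplifier turns \<open>d 1 i\<close> into \<open>d (Suc 0) i\<close> and misses all rules about it\<close>
declare One_nat_def [simp del]

abbreviation "FX k \<equiv> reflector (X k)"
abbreviation "Fd k i \<equiv> refl_map (X (k - 1)) (d k i)"
abbreviation "cl n \<equiv> r_coset (add_monoid (X n)) (star_ideal (X n))"

sublocale p: skew_brace_hom "X 0" B p
  by (intro skew_brace_hom.intro skew_brace_hom_axioms.intro skew_brace_X skew_brace_B aug_hom)

lemma face: "i \<le> Suc n \<Longrightarrow> skew_brace_hom (X (Suc n)) (X n) (d (Suc n) i)"
  by (intro skew_brace_hom.intro skew_brace_hom_axioms.intro skew_brace_X face_hom)

lemma face1: "i \<le> 1 \<Longrightarrow> skew_brace_hom (X 1) (X 0) (d 1 i)"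
  unfolding One_nat_def using face[of i 0] by simp

lemma face2: "i \<le> 2 \<Longrightarrow> skew_brace_hom (X 2) (X 1) (d 2 i)"
  using face[of i 1] by (simp add: numeral_2_eq_2 One_nat_def)

sublocale d10: skew_brace_hom "X 1" "X 0" "d 1 0" by (rule face1) simp
sublocale d11: skew_brace_hom "X 1" "X 0" "d 1 1" by (rule face1) simp

lemma refl_face_one_iff:
  assumes "i \<le> Suc n" "u \<in> carrier (X (Suc n))"
  shows "refl_map (X n) (d (Suc n) i) (cl (Suc n) u) = \<one>\<^bsub>FX n\<^esub> \<longleftrightarrow> d (Suc n) i u \<in> star_ideal (X n)"
  unfolding skew_brace_hom.refl_map_cls[OF face[OF assms(1)] assms(2)]
  by (rule skew_brace.refl_cls_one_iff[OF skew_brace_X sb_hom_closed[OF face_hom[OF assms(1)] assms(2)]])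

text \<open>A face of a class is trivial in the reflector exactly when the face of a representative
  lies in the star ideal. From here on chains of \<open>F(X)\<close> are treated through such
  representatives.\<close>

lemma moore_eq:
  "moore FX Fd (Suc n) = cl (Suc n) ` {u \<in> carrier (X (Suc n)). \<forall>i\<le>n. d (Suc n) i u \<in> star_ideal (X n)}"
proof -
  have "moore FX Fd (Suc n) = cl (Suc n) ` {u \<in> carrier (X (Suc n)).
      \<forall>i\<le>n. refl_map (X n) (d (Suc n) i) (cl (Suc n) u) = \<one>\<^bsub>FX n\<^esub>}"
    by (simp only: moore_def skew_brace.reflector_carrier[OF skew_brace_X] less_Suc_eq_le Compr_image_eq diff_Suc_1)
  also have "{u \<in> carrier (X (Suc n)).
      \<forall>i\<le>n. refl_map (X n) (d (Suc n) i) (cl (Suc n) u) = \<one>\<^bsub>FX n\<^esub>} =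
    {u \<in> carrier (X (Suc n)). \<forall>i\<le>n. d (Suc n) i u \<in> star_ideal (X n)}"
    using refl_face_one_iff by (intro Collect_cong conj_cong all_cong HOL.refl) simp
  finally show ?thesis .
qed

lemma moore_1: "moore FX Fd 1 = cl 1 ` {u \<in> carrier (X 1). d 1 0 u \<in> star_ideal (X 0)}"
  using moore_eq[of 0] by (simp add: One_nat_def)

lemma moore_2: "moore FX Fd 2 =
  cl 2 ` {w \<in> carrier (X 2). d 2 0 w \<in> star_ideal (X 1) \<and> d 2 1 w \<in> star_ideal (X 1)}"
proof -
  have "(\<forall>i\<le>Suc 0. Q i) \<longleftrightarrow> Q 0 \<and> Q (Suc 0)" for Q by (auto simp: le_Suc_eq)
  then show ?thesis using moore_eq[of 1] by (simp add: One_nat_def numeral_2_eq_2)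
qed

lemma d_star_ideal:
  assumes "u \<in> star_ideal (X 1)"
  shows "d 1 0 u \<in> star_ideal (X 0)" "d 1 1 u \<in> star_ideal (X 0)"
  using assms d10.image_star_ideal d11.image_star_ideal by auto

lemma cls_face_eq: "u \<in> star_ideal (X 1) \<Longrightarrow> p.cls (d 1 0 u) = p.cls (d 1 1 u)"
  by (rule p.hom_cls_eq[OF skew_brace_X d10.hom d11.hom aug_face])

text \<open>Each generator of \<open>N\<close> is lifted entry by entry: the entry in
  \<open>K\<close> to some \<open>u\<close> with \<open>d 1 0 u\<close> zero, by
  \<open>exact0\<close>, the others arbitrarily, by \<open>face_surj\<close>. A star with a zero
  entry vanishes, so \<open>d 1 0\<close> kills the lifted generator, and the images under
  \<open>d 1 1\<close> form a subgroup.\<close>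

lemma N_lift:
  assumes "n \<in> p.N"
  shows "\<exists>v\<in>star_ideal (X 1). d 1 0 v = \<zero>\<^bsub>X 0\<^esub> \<and> d 1 1 v = n"
proof -
  let ?V = "d10.K \<inter> star_ideal (X 1)"
  have V: "subgroup ?V (add_monoid (X 1))"
    by (rule d10.K_star_ideal_subgroup)
  have sub: "subgroup (d 1 1 ` ?V) (add_monoid (X 0))"
    by (rule d11.add.subgroup_img_is_subgroup[OF V])
  have lift: "star (X 0) a b \<in> d 1 1 ` ?V" "star (X 0) b a \<in> d 1 1 ` ?V"
    "(c \<oplus>\<^bsub>X 0\<^esub> star (X 0) b a) \<ominus>\<^bsub>X 0\<^esub> c \<in> d 1 1 ` ?V"
    if a: "a \<in> p.K" and b: "b \<in> carrier (X 0)" and c: "c \<in> carrier (X 0)" for a b c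
  proof -
    obtain u where u: "u \<in> carrier (X 1)" "d 1 0 u = \<zero>\<^bsub>X 0\<^esub>" "d 1 1 u = a"
      using exact0[of a] a by (auto simp: p.K_iff)
    obtain v where v: "v \<in> carrier (X 1)" "d 1 1 v = b" using b unfolding face_surj(2)[symmetric] by (rule imageE) simp
    obtain w where w: "w \<in> carrier (X 1)" "d 1 1 w = c" using c unfolding face_surj(2)[symmetric] by (rule imageE) simp
    have dv: "d 1 0 v \<in> carrier (X 0)" "d 1 0 w \<in> carrier (X 0)"
      using v w by simp_all
    have mem: "star (X 1) u v \<in> star_ideal (X 1)" "star (X 1) v u \<in> star_ideal (X 1)"
      "(w \<oplus>\<^bsub>X 1\<^esub> star (X 1) v u) \<ominus>\<^bsub>X 1\<^esub> w \<in> star_ideal (X 1)"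
      unfolding d10.P.star_ideal_eq by (rule d10.P.comm_Grp_memI u v w)+
    have "d 1 0 (star (X 1) u v) = \<zero>\<^bsub>X 0\<^esub>" "d 1 0 (star (X 1) v u) = \<zero>\<^bsub>X 0\<^esub>"
      "d 1 0 ((w \<oplus>\<^bsub>X 1\<^esub> star (X 1) v u) \<ominus>\<^bsub>X 1\<^esub> w) = \<zero>\<^bsub>X 0\<^esub>"
      using u v w dv by (simp_all add: d10.hom_star p.P.star_zero a_minus_def)
    then have V: "star (X 1) u v \<in> ?V" "star (X 1) v u \<in> ?V"
      "(w \<oplus>\<^bsub>X 1\<^esub> star (X 1) v u) \<ominus>\<^bsub>X 1\<^esub> w \<in> ?V"
      using mem u(1) v(1) w(1) by (simp_all add: d10.K_iff a_minus_def)
    show "star (X 0) a b \<in> d 1 1 ` ?V"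
      using u v by (intro image_eqI[OF _ V(1)]) (simp add: d11.hom_star)
    show "star (X 0) b a \<in> d 1 1 ` ?V"
      using u v by (intro image_eqI[OF _ V(2)]) (simp add: d11.hom_star)
    show "(c \<oplus>\<^bsub>X 0\<^esub> star (X 0) b a) \<ominus>\<^bsub>X 0\<^esub> c \<in> d 1 1 ` ?V"
      using u v w by (intro image_eqI[OF _ V(3)]) (simp add: d11.hom_star a_minus_def)
  qed
  \<comment> \<open>A value for the conjugating element \<open>c\<close>, which the first two facts
    of \<open>lift\<close> carry along without mentioning it in their conclusions.\<close>
  have z: "\<zero>\<^bsub>X 0\<^esub> \<in> carrier (X 0)" by simp
  have "p.N \<subseteq> d 1 1 ` ?V"
    by (rule p.P.comm_Grp_least[OF sub lift(1)[OF _ _ z] lift(2)[OF _ _ z] lift(3)])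
  then obtain v where "v \<in> ?V" "n = d 1 1 v" using assms by (meson imageE subsetD)
  then show ?thesis by (auto simp: d10.K_iff)
qed

theorem homology_0:
  "moore_homology FX Fd 0 \<cong> add_monoid B Mod comm_Grp B (carrier B)"
proof -
  let ?q = "cl 0" and ?t = "\<lambda>x. p.B.refl_cls (p x)"
  have t: "group_hom (add_monoid (X 0)) (reflector B) ?t"
    using hom_compose[OF p.add.homh p.B.refl.homh]
      p.P.add_group p.B.reflector_group
    by (simp add: group_hom_def group_hom_axioms_def comp_def)
  have kt: "kernel (add_monoid (X 0)) (reflector B) ?t = {x \<in> carrier (X 0). p x \<in> star_ideal B}"
    by (simp add: kernel_def p.B.refl_cls_one_iff cong: conj_cong)
  have q: "group_hom (add_monoid (X 0)) (FX 0) ?q"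
    by (rule p.P.refl.group_hom_axioms)
  have kq: "kernel (add_monoid (X 0)) (FX 0) ?q = star_ideal (X 0)"
    using p.P.refl_cls_one_iff p.P.star_ideal_subset by (auto simp: kernel_def)
  have "FX 0 Mod ?q ` {x \<in> carrier (X 0). p x \<in> star_ideal B} \<cong> reflector B"
    unfolding kt[symmetric]
  proof (rule Mod_image_kernel_iso[OF q t])
    show "?q ` carrier (add_monoid (X 0)) = carrier (FX 0)" by (simp add: p.P.reflector_carrier)
    show "?t ` carrier (add_monoid (X 0)) = carrier (reflector B)"
      by (simp add: p.B.reflector_carrier image_image flip: aug_surj)
    show "kernel (add_monoid (X 0)) (FX 0) ?q \<subseteq> kernel (add_monoid (X 0)) (reflector B) ?t"
      unfolding kq kt using p.image_star_ideal p.P.star_ideal_subset by auto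
  qed
  moreover have "moore_boundaries FX Fd 0 = ?q ` {x \<in> carrier (X 0). p x \<in> star_ideal B}"
  proof -
    let ?M = "{u \<in> carrier (X 1). d 1 0 u \<in> star_ideal (X 0)}"
    have "moore_boundaries FX Fd 0 = Fd 1 1 ` cl 1 ` ?M"
      unfolding moore_boundaries_def One_nat_def[symmetric] moore_1 by simp
    also have "\<dots> = ?q ` d 1 1 ` ?M"
      using d11.refl_map_cls by (simp add: image_image)
    also have "\<dots> = ?q ` {x \<in> carrier (X 0). p x \<in> star_ideal B}"
    proof (intro equalityI subsetI)
      fix y assume "y \<in> ?q ` d 1 1 ` ?M"
      then obtain u where u: "u \<in> carrier (X 1)" "d 1 0 u \<in> star_ideal (X 0)" "y = ?q (d 1 1 u)"
        by blast
      have "p (d 1 1 u) \<in> star_ideal B"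
        using aug_face[OF u(1)] u(2) p.image_star_ideal by auto
      then show "y \<in> ?q ` {x \<in> carrier (X 0). p x \<in> star_ideal B}"
        using u d11.add.hom_closed[OF u(1)] by blast
    next
      fix y assume "y \<in> ?q ` {x \<in> carrier (X 0). p x \<in> star_ideal B}"
      then obtain x where x: "x \<in> carrier (X 0)" "p x \<in> star_ideal B" "y = ?q x" by blast
      \<comment> \<open>\<open>exact0\<close> needs an element killed by \<open>p\<close>, but
        \<open>p x\<close> is only in the star ideal. Subtracting a preimage of \<open>p x\<close>
        from the star ideal of \<open>X 0\<close> achieves this within the class of
        \<open>x\<close>.\<close>
      obtain s where s: "s \<in> star_ideal (X 0)" "p s = p x"
        using x p.image_star_ideal_surj[OF aug_surj] by (metis imageE)
      have s': "s \<in> carrier (X 0)" using s p.P.star_ideal_subset by blast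
      obtain u where u: "u \<in> carrier (X 1)" "d 1 0 u = \<zero>\<^bsub>X 0\<^esub>" "d 1 1 u = \<ominus>\<^bsub>X 0\<^esub> s \<oplus>\<^bsub>X 0\<^esub> x"
        using exact0[of "\<ominus>\<^bsub>X 0\<^esub> s \<oplus>\<^bsub>X 0\<^esub> x"] x s s' by auto
      have "u \<in> ?M"
        using u p.P.subgroup_add_closed(3)[OF p.P.star_ideal_subgroup] by simp
      moreover have "y = ?q (d 1 1 u)" using u x s p.P.refl_cls_add by simp
      ultimately show "y \<in> ?q ` d 1 1 ` ?M" by blast
    qed
    finally show ?thesis .
  qed
  moreover have "(FX 0)\<lparr>carrier := moore_cycles FX Fd 0\<rparr> = FX 0"
    by (simp add: moore_cycles_def moore_def)
  ultimately show ?thesis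
    by (simp add: moore_homology_def reflector_def p.B.star_ideal_eq)
qed

theorem homology_1: "moore_homology FX Fd 1 \<cong> hopf_quotient (X 0) p.K"
proof -
  let ?I0 = "star_ideal (X 0)" and ?I1 = "star_ideal (X 1)"
  let ?C = "{u \<in> carrier (X 1). d 1 0 u \<in> ?I0 \<and> d 1 1 u \<in> ?I0}"
  define U where "U = (add_monoid (X 1))\<lparr>carrier := ?C\<rparr>"
  \<comment> \<open>For \<open>u\<close> in \<open>?C\<close> both faces lie in the star ideal, and
    \<open>p\<close> does not distinguish them, so their difference is in the numerator of the Hopf
    quotient.\<close>
  define t where "t u = \<ominus>\<^bsub>X 0\<^esub> d 1 0 u \<oplus>\<^bsub>X 0\<^esub> d 1 1 u" for u
  define Z where "Z = (FX 1)\<lparr>carrier := moore_cycles FX Fd 1\<rparr>"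
  note I0 = p.P.subgroup_add_closed[OF p.P.star_ideal_subgroup]
  note I1 = d10.P.subgroup_add_closed[OF d10.P.star_ideal_subgroup]
  have I1_C: "?I1 \<subseteq> ?C"
    using d_star_ideal d10.P.star_ideal_subset by auto
  have subU: "subgroup ?C (add_monoid (X 1))"
    using I1_C I1 I0 by (intro d10.P.add.subgroupI) (auto simp flip: a_inv_def)
  then have U: "group U"
    unfolding U_def by (rule d10.P.add.subgroup_imp_group)
  have cU: "carrier U = ?C" and mU: "u \<otimes>\<^bsub>U\<^esub> v = u \<oplus>\<^bsub>X 1\<^esub> v" for u v
    by (simp_all add: U_def)
  have t_closed: "t u \<in> p.K" if "u \<in> carrier (X 1)" for u
    using that aug_face[OF that] by (simp add: t_def p.K_iff)
  have t_N: "t u \<in> p.N \<longleftrightarrow> p.cls (d 1 0 u) = p.cls (d 1 1 u)" if u: "u \<in> carrier (X 1)" for u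
  proof -
    have "t u \<in> p.N \<longleftrightarrow> p.cls (t u) = \<one>\<^bsub>add_monoid (X 0) Mod p.N\<^esub>"
      using p.cls_eq_one_iff[of "t u"] t_closed[OF u] p.K_subset by blast
    also have "\<dots> \<longleftrightarrow> inv\<^bsub>add_monoid (X 0) Mod p.N\<^esub> p.cls (d 1 0 u) \<otimes>\<^bsub>add_monoid (X 0) Mod p.N\<^esub> p.cls (d 1 1 u)
        = \<one>\<^bsub>add_monoid (X 0) Mod p.N\<^esub>"
      using u by (simp add: t_def del: mult_FactGroup one_FactGroup)
    also have "\<dots> \<longleftrightarrow> p.cls (d 1 0 u) = p.cls (d 1 1 u)"
      using u p.cls.H.inv_solve_left'[of "\<one>\<^bsub>add_monoid (X 0) Mod p.N\<^esub>" "p.cls (d 1 0 u)" "p.cls (d 1 1 u)"]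
      by (auto simp del: mult_FactGroup one_FactGroup)
    finally show ?thesis .
  qed
  have t_hom: "group_hom U (hopf_quotient (X 0) p.K) (\<lambda>u. p.cls (t u))"
  proof (rule p.hopf_group_hom[OF U])
    show "t u \<in> p.K \<inter> ?I0" if "u \<in> carrier U" for u
      using that t_closed[of u] I0 by (simp add: cU t_def)
    fix u v assume "u \<in> carrier U" "v \<in> carrier U"
    then have u: "u \<in> carrier (X 1)" and v: "v \<in> carrier (X 1)" "d 1 0 v \<in> ?I0"
      by (simp_all add: cU)
    \<comment> \<open>\<open>t u + t v\<close> and \<open>t (u + v)\<close> differ only in the order
      of \<open>t u\<close> and \<open>?w\<close>. The former is in \<open>K\<close>, the latter in
      the star ideal, so they commute modulo \<open>N\<close>.\<close>
    let ?w = "\<ominus>\<^bsub>X 0\<^esub> d 1 0 v"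
    have tu: "t u \<in> carrier (X 0)" using t_closed[OF u] p.K_subset by blast
    have "p.cls ((t u \<oplus>\<^bsub>X 0\<^esub> ?w) \<ominus>\<^bsub>X 0\<^esub> t u) = p.cls ?w"
      using t_closed[OF u] I0 v by (intro p.cls_conj_star_ideal) auto
    then have "p.cls (((t u \<oplus>\<^bsub>X 0\<^esub> ?w) \<ominus>\<^bsub>X 0\<^esub> t u) \<oplus>\<^bsub>X 0\<^esub> (t u \<oplus>\<^bsub>X 0\<^esub> d 1 1 v)) =
        p.cls (?w \<oplus>\<^bsub>X 0\<^esub> (t u \<oplus>\<^bsub>X 0\<^esub> d 1 1 v))"
      using tu v by (simp add: a_minus_def del: mult_FactGroup one_FactGroup)
    moreover have "((t u \<oplus>\<^bsub>X 0\<^esub> ?w) \<ominus>\<^bsub>X 0\<^esub> t u) \<oplus>\<^bsub>X 0\<^esub> (t u \<oplus>\<^bsub>X 0\<^esub> d 1 1 v) = t u \<oplus>\<^bsub>X 0\<^esub> t v"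
      using tu v by (simp add: t_def[of v] p.P.add_word)
    moreover have "?w \<oplus>\<^bsub>X 0\<^esub> (t u \<oplus>\<^bsub>X 0\<^esub> d 1 1 v) = t (u \<oplus>\<^bsub>X 1\<^esub> v)"
      using u v by (simp add: t_def p.P.add_word)
    ultimately show "p.cls (t (u \<otimes>\<^bsub>U\<^esub> v)) = p.cls (t u \<oplus>\<^bsub>X 0\<^esub> t v)"
      by (simp add: mU)
  qed
  have kt: "kernel U (hopf_quotient (X 0) p.K) (\<lambda>u. p.cls (t u)) = {u \<in> ?C. t u \<in> p.N}"
    unfolding cU[symmetric] by (rule p.hopf_kernel) (use t_closed p.K_subset in \<open>auto simp: cU\<close>)
  have cycles: "moore_cycles FX Fd 1 = cl 1 ` ?C"
    using refl_face_one_iff[of 1 0, folded One_nat_def] by (auto simp: moore_cycles_def moore_1)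
  have Z_eq: "Z = (add_monoid (X 1))\<lparr>carrier := ?C\<rparr> Mod ?I1"
    unfolding Z_def cycles FactGroup_carrier_update unfolding reflector_def ..
  have "?I1 \<lhd> (add_monoid (X 1))\<lparr>carrier := ?C\<rparr>"
    by (rule d10.P.add.normal_restrict_supergroup[OF subU d10.P.star_ideal_normal I1_C])
  then have Z: "group Z"
    unfolding Z_eq by (rule normal.factorgroup_is_group)
  have cZ: "carrier Z = cl 1 ` ?C" by (simp add: Z_def cycles)
  have "cl 1 \<in> hom U Z"
    using d10.P.refl.hom_mult unfolding Z_def
    by (intro homI) (auto simp: cU mU cycles)
  then have q_hom: "group_hom U Z (cl 1)"
    using U Z by (simp add: group_hom_def group_hom_axioms_def)
  have kq: "kernel U Z (cl 1) = ?I1"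
    using d10.P.refl_cls_one_iff I1_C by (auto simp: kernel_def Z_def cU)
  have "Z Mod cl 1 ` {u \<in> ?C. t u \<in> p.N} \<cong> hopf_quotient (X 0) p.K"
    unfolding kt[symmetric]
  proof (rule Mod_image_kernel_iso[OF q_hom t_hom])
    show "cl 1 ` carrier U = carrier Z" by (simp add: cU cZ)
    show "(\<lambda>u. p.cls (t u)) ` carrier U = carrier (hopf_quotient (X 0) p.K)"
    proof (intro equalityI subsetI)
      fix c assume "c \<in> carrier (hopf_quotient (X 0) p.K)"
      then obtain k where k: "k \<in> p.K" "k \<in> ?I0" "c = p.cls k"
        by (auto simp: p.hopf_quotient_eq)
      then obtain u where u: "u \<in> carrier (X 1)" "d 1 0 u = \<zero>\<^bsub>X 0\<^esub>" "d 1 1 u = k"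
        using exact0[of k] by (auto simp: p.K_iff)
      have "u \<in> ?C" "t u = k" using u k I0(3) p.K_subset by (auto simp: t_def)
      then show "c \<in> (\<lambda>u. p.cls (t u)) ` carrier U" using k by (auto simp: cU)
    qed (use group_hom.hom_closed[OF t_hom] in blast)
    show "kernel U Z (cl 1) \<subseteq> kernel U (hopf_quotient (X 0) p.K) (\<lambda>u. p.cls (t u))"
      unfolding kq kt using I1_C t_N cls_face_eq by auto
  qed
  moreover have "moore_boundaries FX Fd 1 = cl 1 ` {u \<in> ?C. t u \<in> p.N}"
  proof -
    let ?M = "{w \<in> carrier (X 2). d 2 0 w \<in> ?I1 \<and> d 2 1 w \<in> ?I1}"
    have two: "(2::nat) - 1 = 1" by simp
    have "moore_boundaries FX Fd 1 = refl_map (X 1) (d 2 2) ` cl 2 ` ?M"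
      unfolding moore_boundaries_def Suc_1 moore_2 two ..
    also have "\<dots> = cl 1 ` d 2 2 ` ?M"
      unfolding image_image by (intro image_cong HOL.refl skew_brace_hom.refl_map_cls[OF face2]) simp_all
    also have "\<dots> = cl 1 ` {u \<in> ?C. t u \<in> p.N}"
    proof (intro equalityI subsetI)
      fix y assume "y \<in> cl 1 ` d 2 2 ` ?M"
      then obtain w where w: "w \<in> carrier (X 2)" "d 2 0 w \<in> ?I1" "d 2 1 w \<in> ?I1" "y = cl 1 (d 2 2 w)"
        by blast
      have dw: "d 2 2 w \<in> carrier (X 1)"
        using w(1) face_hom[of 2 1] by (simp add: sb_hom_closed Suc_1)
      then have "d 2 2 w \<in> ?C"
        using w face_face d_star_ideal by simp
      \<comment> \<open>The two faces of \<open>d 2 2 w\<close> are \<open>d 1 1 (d 2 0 w)\<close>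
        and \<open>d 1 1 (d 2 1 w)\<close>. Modulo \<open>N\<close>, \<open>d 1 1\<close> may be
        replaced by \<open>d 1 0\<close> on the star ideal, and then the two coincide.\<close>
      moreover have "p.cls (d 1 0 (d 2 2 w)) = p.cls (d 1 1 (d 2 2 w))"
        using cls_face_eq[OF w(2)] cls_face_eq[OF w(3)] face_face[OF w(1)] by simp
      ultimately show "y \<in> cl 1 ` {u \<in> ?C. t u \<in> p.N}"
        using w(4) t_N[OF dw] by blast
    next
      fix y assume "y \<in> cl 1 ` {u \<in> ?C. t u \<in> p.N}"
      then obtain u where u: "u \<in> carrier (X 1)" "d 1 0 u \<in> ?I0" "t u \<in> p.N" "y = cl 1 u"
        by blast
      \<comment> \<open>First correction, inside the star ideal so that the class \<open>y\<close>
        is kept: it makes \<open>d 1 0\<close> vanish. The faces of \<open>s\<close> are congruent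
        modulo \<open>N\<close>, and so are those of \<open>u\<close>, hence
        \<open>d 1 1 ?u1\<close> falls into \<open>N\<close>.\<close>
      obtain s where s: "s \<in> ?I1" "d 1 0 s = d 1 0 u"
        using u(2) d10.image_star_ideal_surj[OF face_surj(1)] by (metis imageE)
      have s': "s \<in> carrier (X 1)" using s d10.P.star_ideal_subset by blast
      let ?u1 = "\<ominus>\<^bsub>X 1\<^esub> s \<oplus>\<^bsub>X 1\<^esub> u"
      have u1: "?u1 \<in> carrier (X 1)" "d 1 0 ?u1 = \<zero>\<^bsub>X 0\<^esub>" using u s s' by simp_all
      have "p.cls (d 1 1 s) = p.cls (d 1 1 u)"
        using cls_face_eq[OF s(1)] t_N[OF u(1)] u(3) s(2) by simp
      then have "p.cls (d 1 1 ?u1) = \<one>\<^bsub>add_monoid (X 0) Mod p.N\<^esub>"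
        using u s' by (simp del: mult_FactGroup one_FactGroup)
      then have "d 1 1 ?u1 \<in> p.N"
        using p.cls_eq_one_iff[of "d 1 1 ?u1"] d11.add.hom_closed[OF u1(1)] by blast
      \<comment> \<open>Second correction, again inside the star ideal: it removes
        \<open>d 1 1 ?u1\<close> without disturbing the vanishing of \<open>d 1 0\<close>, so that
        \<open>exact1\<close> applies to \<open>?u2\<close>.\<close>
      then obtain v where v: "v \<in> ?I1" "d 1 0 v = \<zero>\<^bsub>X 0\<^esub>" "d 1 1 v = d 1 1 ?u1"
        using N_lift by blast
      have v': "v \<in> carrier (X 1)" using v d10.P.star_ideal_subset by blast
      let ?u2 = "\<ominus>\<^bsub>X 1\<^esub> v \<oplus>\<^bsub>X 1\<^esub> ?u1"
      \<comment> \<open>Only the outer sum is expanded, so that \<open>d 1 1 ?u1\<close> stays in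
        the form in which \<open>v\<close> was chosen to match it.\<close>
      have "d 1 1 ?u2 = \<ominus>\<^bsub>X 0\<^esub> d 1 1 v \<oplus>\<^bsub>X 0\<^esub> d 1 1 ?u1"
        using v' u1(1) by (simp del: d11.add.hom_mult add: d11.add.hom_mult[of "\<ominus>\<^bsub>X 1\<^esub> v" ?u1])
      then have "?u2 \<in> carrier (X 1)" "d 1 0 ?u2 = \<zero>\<^bsub>X 0\<^esub>" "d 1 1 ?u2 = \<zero>\<^bsub>X 0\<^esub>"
        using v v' u1 by auto
      then obtain w where w: "w \<in> carrier (X 2)" "d 2 0 w = \<zero>\<^bsub>X 1\<^esub>" "d 2 1 w = \<zero>\<^bsub>X 1\<^esub>" "d 2 2 w = ?u2"
        using exact1[of ?u2] by blast
      have "w \<in> ?M" using w I1(3) by simp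
      moreover have "y = cl 1 (d 2 2 w)"
        using d10.P.refl_cls_add[OF u1(1) v(1)] d10.P.refl_cls_add[OF u(1) s(1)] u(4) w(4) by simp
      ultimately show "y \<in> cl 1 ` d 2 2 ` ?M" by blast
    qed
    finally show ?thesis .
  qed
  ultimately show ?thesis
    by (simp add: moore_homology_def Z_def)
qed

end

section \<open>Transport of structure\<close>

lemma sb_hom_inv_into:
  assumes A: "skew_brace A" and h: "h \<in> sb_hom A B" and bij: "bij_betw h (carrier A) (carrier B)"
  shows "inv_into (carrier A) h \<in> sb_hom B A"
proof -
  interpret A: skew_brace A by fact
  have "h \<in> iso (add_monoid A) (add_monoid B)" "h \<in> iso A B"
    using h bij by (simp_all add: iso_def sb_hom_def)
  then have "inv_into (carrier A) h \<in> iso (add_monoid B) (add_monoid A)"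
      "inv_into (carrier A) h \<in> iso B A"
    using group.iso_set_sym[OF A.add_group] group.iso_set_sym[OF A.circ_group] by force+
  then show ?thesis by (simp add: iso_def sb_hom_def)
qed

lemma
  assumes R: "skew_brace R" and f: "inj_on f (carrier R)"
  shows image_ring_hom: "f \<in> sb_hom R (image_ring f R)"
    and skew_brace_image_ring: "skew_brace (image_ring f R)"
    and inv_image_ring_hom: "inv_into (carrier R) f \<in> sb_hom (image_ring f R) R"
proof -
  interpret R: skew_brace R by fact
  let ?S = "image_ring f R"
  have c: "carrier ?S = f ` carrier R" by (rule image_ring_carrier)
  have add: "f x \<oplus>\<^bsub>?S\<^esub> f y = f (x \<oplus>\<^bsub>R\<^esub> y)"
    and mult: "f x \<otimes>\<^bsub>?S\<^esub> f y = f (x \<otimes>\<^bsub>R\<^esub> y)" if "x \<in> carrier R" "y \<in> carrier R" for x y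
    using that f by (simp_all add: image_ring_def image_group_def monoid.defs)
  show hom: "f \<in> sb_hom R ?S"
    by (auto simp: sb_hom_def hom_def c add mult)
  have ga: "group (add_monoid ?S)"
  proof (rule groupI, goal_cases)
    case (5 x)
    then obtain y where "y \<in> carrier R" "x = f y" by (auto simp: c)
    then show ?case
      by (intro bexI[of _ "f (\<ominus>\<^bsub>R\<^esub> y)"]) (auto simp: c add image_ring_zero)
  qed (auto simp: c add image_ring_zero R.add.m_assoc)
  have gm: "group ?S"
  proof (rule groupI, goal_cases)
    case (5 x)
    then obtain y where "y \<in> carrier R" "x = f y" by (auto simp: c)
    then show ?case
      by (intro bexI[of _ "f (inv\<^bsub>R\<^esub> y)"]) (auto simp: c mult image_ring_one)
  qed (auto simp: c mult image_ring_one R.circ.m_assoc)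
  have neg: "\<ominus>\<^bsub>?S\<^esub> f x = f (\<ominus>\<^bsub>R\<^esub> x)" if "x \<in> carrier R" for x
    using group_hom.hom_inv[of "add_monoid R" "add_monoid ?S" f x] R.add_group ga hom that
    by (simp add: group_hom_def group_hom_axioms_def sb_hom_def a_inv_def)
  show "skew_brace ?S"
  proof (rule skew_brace.intro[OF ga gm])
    fix a b d assume "a \<in> carrier ?S" "b \<in> carrier ?S" "d \<in> carrier ?S"
    then obtain x y z where "x \<in> carrier R" "y \<in> carrier R" "z \<in> carrier R"
        "a = f x" "b = f y" "d = f z"
      by (auto simp: c)
    then show "a \<otimes>\<^bsub>?S\<^esub> (b \<oplus>\<^bsub>?S\<^esub> d) = (a \<otimes>\<^bsub>?S\<^esub> b \<ominus>\<^bsub>?S\<^esub> a) \<oplus>\<^bsub>?S\<^esub> (a \<otimes>\<^bsub>?S\<^esub> d)"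
      by (simp add: a_minus_def neg add mult R.brace)
  qed
  show "inv_into (carrier R) f \<in> sb_hom ?S R"
    using f by (intro sb_hom_inv_into R hom) (simp add: bij_betw_def c)
qed

section \<open>The free skew brace comonad\<close>

lemma sb_class_eq_mem: "t \<in> sb_class X s \<Longrightarrow> sb_class X t = sb_class X s"
  by (rule sb_class_eqI) (simp add: sb_class_def)

text \<open>A class is determined by any of its members, in particular by the one that
  \<open>SOME\<close> picks.\<close>

lemma inj_on_code_word: "inj_on code_word (carrier (free_sb X))"
proof (rule inj_onI)
  fix c d assume c: "c \<in> carrier (free_sb X)" and d: "d \<in> carrier (free_sb X)"
    and eq: "code_word c = code_word d"
  have some: "(SOME t. t \<in> c) \<in> c \<and> c = sb_class X (SOME t. t \<in> c)"
    if "c \<in> carrier (free_sb X)" for c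
  proof -
    obtain s where s: "set_sbterm s \<subseteq> X" "c = sb_class X s"
      using \<open>c \<in> _\<close> by (auto simp: free_sb_carrier)
    then have "(SOME t. t \<in> c) \<in> c" using sb_class_self[OF s(1)] by (auto intro: someI)
    then show ?thesis using sb_class_eq_mem s by blast
  qed
  have "(SOME t. t \<in> c) = (SOME t. t \<in> d)" using eq by (simp add: code_word_def)
  then show "c = d" using some[OF c] some[OF d] by simp
qed

lemmas code_word_hom = image_ring_hom[OF skew_brace_free_sb inj_on_code_word]

lemma skew_brace_G: "skew_brace (G_obj A)"
  unfolding G_obj_def by (rule skew_brace_image_ring[OF skew_brace_free_sb inj_on_code_word])

lemma G_gen_closed: "x \<in> carrier A \<Longrightarrow> G_gen A x \<in> carrier (G_obj A)"
  by (simp add: G_gen_def G_obj_def image_ring_carrier free_gen_closed)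

lemma G_lift_hom:
  assumes "skew_brace C" "f \<in> carrier A \<rightarrow> carrier C"
  shows "G_lift A C f \<in> sb_hom (G_obj A) C"
  using sb_hom_comp[OF inv_image_ring_hom[OF skew_brace_free_sb inj_on_code_word]
      free_lift_hom[OF assms]]
  by (simp add: G_lift_def[abs_def] G_obj_def comp_def)

lemma G_lift_gen:
  assumes "skew_brace C" "f \<in> carrier A \<rightarrow> carrier C" "x \<in> carrier A"
  shows "G_lift A C f (G_gen A x) = f x"
  using free_lift_gen[OF assms] inj_on_code_word[of "carrier A"] free_gen_closed[OF assms(3)]
  by (simp add: G_lift_def G_gen_def)

lemma G_hom_eq:
  assumes C: "skew_brace C" and h: "h \<in> sb_hom (G_obj A) C" and k: "k \<in> sb_hom (G_obj A) C"
    and eq: "\<And>x. x \<in> carrier A \<Longrightarrow> h (G_gen A x) = k (G_gen A x)"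
    and w: "w \<in> carrier (G_obj A)"
  shows "h w = k w"
proof -
  obtain c where c: "c \<in> carrier (free_sb (carrier A))" "w = code_word c"
    using w by (auto simp: G_obj_def image_ring_carrier)
  have "(h \<circ> code_word) c = (k \<circ> code_word) c"
  proof (rule free_sb_hom_unique[OF C _ _ _ c(1)])
    show "h \<circ> code_word \<in> sb_hom (free_sb (carrier A)) C" "k \<circ> code_word \<in> sb_hom (free_sb (carrier A)) C"
      using sb_hom_comp[OF code_word_hom] h k by (simp_all add: G_obj_def)
  qed (use eq in \<open>simp add: G_gen_def\<close>)
  then show ?thesis using c by simp
qed

lemma G_map_hom: "f \<in> carrier A \<rightarrow> carrier C \<Longrightarrow> G_map A C f \<in> sb_hom (G_obj A) (G_obj C)"
  unfolding G_map_def by (intro G_lift_hom skew_brace_G) (auto intro: G_gen_closed)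

lemma G_map_gen:
  "\<lbrakk>f \<in> carrier A \<rightarrow> carrier C; x \<in> carrier A\<rbrakk> \<Longrightarrow> G_map A C f (G_gen A x) = G_gen C (f x)"
  unfolding G_map_def by (intro G_lift_gen skew_brace_G) (auto intro: G_gen_closed)

text \<open>Functions are total while the functor sees them only on carriers, so the composite
  enters as any \<open>k\<close> that agrees with it there. Two different factorisations can thus be
  compared through the same \<open>k\<close>.\<close>

lemma G_map_comp:
  assumes f: "f \<in> carrier A \<rightarrow> carrier C" and g: "g \<in> carrier C \<rightarrow> carrier D"
    and k: "k \<in> carrier A \<rightarrow> carrier D"
    and eq: "\<And>x. x \<in> carrier A \<Longrightarrow> g (f x) = k x" and w: "w \<in> carrier (G_obj A)"
  shows "G_map C D g (G_map A C f w) = G_map A D k w"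
proof -
  have "(G_map C D g \<circ> G_map A C f) w = G_map A D k w"
    by (rule G_hom_eq[OF skew_brace_G sb_hom_comp[OF G_map_hom[OF f] G_map_hom[OF g]] G_map_hom[OF k] _ w])
      (simp add: G_map_gen f g k eq funcset_mem[OF f])
  then show ?thesis by simp
qed

lemma G_map_id:
  assumes w: "w \<in> carrier (G_obj A)"
  shows "G_map A A (\<lambda>x. x) w = w"
proof -
  have "G_map A A (\<lambda>x. x) w = id w"
    by (rule G_hom_eq[OF skew_brace_G G_map_hom sb_hom_id _ w]) (simp_all add: G_map_gen)
  then show ?thesis by simp
qed

text \<open>Plain functions between carriers suffice here, which allows \<open>f\<close> to be the
  unit \<open>G_gen\<close>, a map that is not a homomorphism.\<close>

lemma G_map_retract:
  assumes "f \<in> carrier A \<rightarrow> carrier C" "g \<in> carrier C \<rightarrow> carrier A"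
    and "\<And>x. x \<in> carrier A \<Longrightarrow> g (f x) = x" and "w \<in> carrier (G_obj A)"
  shows "G_map C A g (G_map A C f w) = w"
  using G_map_comp[OF assms(1,2), of "\<lambda>x. x"] assms by (simp add: G_map_id)

lemma G_counit_hom: "skew_brace A \<Longrightarrow> G_counit A \<in> sb_hom (G_obj A) A"
  unfolding G_counit_def by (rule G_lift_hom) auto

lemma G_counit_gen: "\<lbrakk>skew_brace A; x \<in> carrier A\<rbrakk> \<Longrightarrow> G_counit A (G_gen A x) = x"
  unfolding G_counit_def by (rule G_lift_gen) auto

lemma sb_hom_funcset: "h \<in> sb_hom A B \<Longrightarrow> h \<in> carrier A \<rightarrow> carrier B"
  by (auto simp: sb_hom_def hom_def)

text \<open>Instances with \<open>f\<close> itself a counit, or the image of one under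
  \<open>G_map\<close>, are the simplicial identities that involve the face with index 0.\<close>

lemma G_counit_natural:
  assumes "skew_brace A" "skew_brace C" and f: "f \<in> sb_hom A C" and w: "w \<in> carrier (G_obj A)"
  shows "G_counit C (G_map A C f w) = f (G_counit A w)"
proof -
  note f' = sb_hom_funcset[OF f]
  have "(G_counit C \<circ> G_map A C f) w = (f \<circ> G_counit A) w"
    by (rule G_hom_eq[OF assms(2) sb_hom_comp[OF G_map_hom[OF f'] G_counit_hom[OF assms(2)]]
          sb_hom_comp[OF G_counit_hom[OF assms(1)] f] _ w])
      (simp add: G_map_gen G_counit_gen assms f' funcset_mem[OF f'])
  then show ?thesis by simp
qed

lemma G_map_pow_hom:
  assumes "f \<in> sb_hom A C"
  shows "G_map_pow i A C f \<in> sb_hom ((G_obj ^^ i) A) ((G_obj ^^ i) C)"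
  by (induction i) (simp_all add: assms G_map_hom sb_hom_funcset)

lemma skew_brace_G_pow: "skew_brace A \<Longrightarrow> skew_brace ((G_obj ^^ n) A)"
  by (cases n) (simp_all add: skew_brace_G)

lemma G_face_hom:
  assumes A: "skew_brace A" and i: "i \<le> Suc n"
  shows "G_face A (Suc n) i \<in> sb_hom (G_simp A (Suc n)) (G_simp A n)"
proof -
  have pow: "(G_obj ^^ i) ((G_obj ^^ m) A) = (G_obj ^^ (i + m)) A" for m
    by (simp add: funpow_add)
  have "(G_obj ^^ i) ((G_obj ^^ Suc (Suc n - i)) A) = G_simp A (Suc n)"
      "(G_obj ^^ i) ((G_obj ^^ (Suc n - i)) A) = G_simp A n"
    using i unfolding pow G_simp_def by (simp_all del: funpow.simps)
  moreover have "G_counit ((G_obj ^^ (Suc n - i)) A)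
      \<in> sb_hom ((G_obj ^^ Suc (Suc n - i)) A) ((G_obj ^^ (Suc n - i)) A)"
    using G_counit_hom[OF skew_brace_G_pow[OF A, of "Suc n - i"]] by simp
  ultimately show ?thesis
    using G_map_pow_hom[of "G_counit ((G_obj ^^ (Suc n - i)) A)"
        "(G_obj ^^ Suc (Suc n - i)) A" "(G_obj ^^ (Suc n - i)) A" i]
    by (simp only: G_face_def)
qed

text \<open>
  Asphericity: the unit \<open>G_gen\<close> is a contraction of the underlying simplicial sets, but it is not
  a homomorphism; differences of its values are corrected by the degeneracies \<open>G\<^sup>i \<delta>\<close>, where
  \<open>\<delta> = G_comult\<close>.
\<close>

definition G_comult :: "'a tower ring \<Rightarrow> 'a tower \<Rightarrow> 'a tower"
  where "G_comult A = G_map A (G_obj A) (G_gen A)"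

lemma G_gen_funcset: "G_gen A \<in> carrier A \<rightarrow> carrier (G_obj A)"
  by (auto intro: G_gen_closed)

lemma G_comult_hom: "G_comult A \<in> sb_hom (G_obj A) (G_obj (G_obj A))"
  unfolding G_comult_def by (rule G_map_hom[OF G_gen_funcset])

lemma G_counit_comult:
  assumes w: "w \<in> carrier (G_obj A)"
  shows "G_counit (G_obj A) (G_comult A w) = w"
proof -
  have "(G_counit (G_obj A) \<circ> G_comult A) w = id w"
    by (rule G_hom_eq[OF skew_brace_G sb_hom_comp[OF G_comult_hom G_counit_hom] sb_hom_id _ w])
      (simp_all add: skew_brace_G G_comult_def G_map_gen G_gen_funcset G_counit_gen G_gen_closed)
  then show ?thesis by simp
qed

lemma G_map_counit_comult:
  assumes A: "skew_brace A" and w: "w \<in> carrier (G_obj A)"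
  shows "G_map (G_obj A) A (G_counit A) (G_comult A w) = w"
  unfolding G_comult_def
  by (rule G_map_retract[OF G_gen_funcset sb_hom_funcset[OF G_counit_hom[OF A]] G_counit_gen[OF A] w])

lemma G_map_G_map_comult:
  assumes f: "f \<in> carrier A \<rightarrow> carrier C" and w: "w \<in> carrier (G_obj A)"
  shows "G_map (G_obj A) (G_obj C) (G_map A C f) (G_comult A w) = G_comult C (G_map A C f w)"
proof -
  note Gf = sb_hom_funcset[OF G_map_hom[OF f]]
  have k: "(\<lambda>x. G_gen C (f x)) \<in> carrier A \<rightarrow> carrier (G_obj C)"
    using f by (auto intro: G_gen_closed)
  show ?thesis
    unfolding G_comult_def
    using G_map_comp[OF G_gen_funcset Gf k _ w] G_map_comp[OF f G_gen_funcset k _ w] f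
    by (simp add: G_map_gen)
qed

section \<open>The augmented comonadic object in low degrees\<close>

lemma G_face_simps:
  "G_face A 1 0 = G_counit (G_obj A)"
  "G_face A 1 1 = G_map (G_obj A) A (G_counit A)"
  "G_face A 2 0 = G_counit (G_obj (G_obj A))"
  "G_face A 2 1 = G_map (G_obj (G_obj A)) (G_obj A) (G_counit (G_obj A))"
  "G_face A 2 2 = G_map (G_obj (G_obj A)) (G_obj A) (G_map (G_obj A) A (G_counit A))"
  by (simp_all add: G_face_def numeral_2_eq_2)

lemma G_simp_simps:
  "G_simp A 0 = G_obj A" "G_simp A 1 = G_obj (G_obj A)" "G_simp A 2 = G_obj (G_obj (G_obj A))"
  by (simp_all add: G_simp_def numeral_2_eq_2)

text \<open>The tower starts from a copy \<open>A\<close> of the given skew brace; composing the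
  augmentation with the isomorphism \<open>g\<close> makes the simplicial object resolve
  \<open>B\<close> itself.\<close>

lemma G_aspherical:
  assumes A: "skew_brace A" and B: "skew_brace B"
    and g: "g \<in> sb_hom A B" and bij: "bij_betw g (carrier A) (carrier B)"
  shows "aspherical_simplicial_skew_brace (G_simp A) (G_face A) B (\<lambda>w. g (G_counit A w))"
proof -
  let ?G1 = "G_obj A" and ?G2 = "G_obj (G_obj A)" and ?G3 = "G_obj (G_obj (G_obj A))"
  let ?e = "G_counit A" and ?e1 = "G_counit ?G1" and ?e2 = "G_counit ?G2"
  let ?Ge = "G_map ?G1 A ?e" and ?Ge1 = "G_map ?G2 ?G1 ?e1" and ?GGe = "G_map ?G2 ?G1 (G_map ?G1 A ?e)"
  have hom: "skew_brace_hom P Q h" if "skew_brace P" "skew_brace Q" "h \<in> sb_hom P Q"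
    for P Q :: "'a tower ring" and h
    by (intro skew_brace_hom.intro skew_brace_hom_axioms.intro that)
  note sb = A skew_brace_G
  have e: "?e \<in> sb_hom ?G1 A" and e1: "?e1 \<in> sb_hom ?G2 ?G1" and e2: "?e2 \<in> sb_hom ?G3 ?G2"
    by (intro G_counit_hom sb)+
  note Gmap = G_map_hom[OF sb_hom_funcset]
  have Ge: "?Ge \<in> sb_hom ?G2 ?G1" by (rule Gmap[OF e])
  have Ge1: "?Ge1 \<in> sb_hom ?G3 ?G2" by (rule Gmap[OF e1])
  have GGe: "?GGe \<in> sb_hom ?G3 ?G2" by (rule Gmap[OF Ge])
  have s: "G_comult A \<in> sb_hom ?G1 ?G2" and s0: "G_comult ?G1 \<in> sb_hom ?G2 ?G3"
    by (rule G_comult_hom)+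
  let ?s1 = "G_map ?G1 ?G2 (G_comult A)"
  have s1: "?s1 \<in> sb_hom ?G2 ?G3"
    by (rule Gmap[OF s])
  interpret e: skew_brace_hom ?G1 A ?e by (intro hom sb e)
  interpret e1: skew_brace_hom ?G2 ?G1 ?e1 by (intro hom sb e1)
  interpret Ge: skew_brace_hom ?G2 ?G1 ?Ge by (intro hom sb Ge)
  interpret e2: skew_brace_hom ?G3 ?G2 ?e2 by (intro hom sb e2)
  interpret Ge1: skew_brace_hom ?G3 ?G2 ?Ge1 by (intro hom sb Ge1)
  interpret GGe: skew_brace_hom ?G3 ?G2 ?GGe by (intro hom sb GGe)
  interpret s: skew_brace_hom ?G1 ?G2 "G_comult A" by (intro hom sb s)
  have aug: "?e (?e1 x) = ?e (?Ge x)" if "x \<in> carrier ?G2" for x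
    using G_counit_natural[OF _ A e that] by (simp add: skew_brace_G)
  have g_zero: "x = \<zero>\<^bsub>A\<^esub>" if "x \<in> carrier A" "g x = \<zero>\<^bsub>B\<^esub>" for x
  proof -
    interpret g: skew_brace_hom A B g
      by (intro skew_brace_hom.intro skew_brace_hom_axioms.intro A B g)
    show ?thesis
      using bij_betw_imp_inj_on[OF bij] that g.add.hom_one
      by (metis e.B.add.one_closed inj_onD)
  qed
  show ?thesis
  proof (rule aspherical_simplicial_skew_brace.intro, unfold G_simp_simps G_face_simps)
    show "skew_brace (G_simp A n)" for n
      unfolding G_simp_def by (rule skew_brace_G_pow[OF A])
    show "skew_brace B" by (rule B)
    show "G_face A (Suc n) i \<in> sb_hom (G_simp A (Suc n)) (G_simp A n)" if "i \<le> Suc n" for n i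
      by (rule G_face_hom[OF A that])
    show "(\<lambda>w. g (?e w)) \<in> sb_hom ?G1 B"
      using sb_hom_comp[OF e g] by (simp add: comp_def)
    show "g (?e (?e1 x)) = g (?e (?Ge x))" if "x \<in> carrier ?G2" for x
      using aug[OF that] by simp
    show "?e1 (?Ge1 x) = ?e1 (?e2 x)" if "x \<in> carrier ?G3" for x
      by (rule G_counit_natural[OF skew_brace_G skew_brace_G e1 that])
    show "?e1 (?GGe x) = ?Ge (?e2 x)" if "x \<in> carrier ?G3" for x
      by (rule G_counit_natural[OF skew_brace_G skew_brace_G Ge that])
    show "?Ge (?GGe x) = ?Ge (?Ge1 x)" if x: "x \<in> carrier ?G3" for x
    proof -
      have k: "(\<lambda>x. ?e (?e1 x)) \<in> carrier ?G2 \<rightarrow> carrier A" by auto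
      show ?thesis
        using G_map_comp[OF sb_hom_funcset[OF Ge] sb_hom_funcset[OF e] k _ x]
          G_map_comp[OF sb_hom_funcset[OF e1] sb_hom_funcset[OF e] k _ x] aug
        by simp
    qed
    have "x \<in> ?e ` carrier ?G1" if "x \<in> carrier A" for x
      using G_counit_gen[OF A that] G_gen_closed[OF that] by (metis imageI)
    then have "?e ` carrier ?G1 = carrier A" by auto
    then show "(\<lambda>w. g (?e w)) ` carrier ?G1 = carrier B"
      using bij by (simp add: bij_betw_def flip: image_image[of g ?e])
    have "x \<in> ?e1 ` carrier ?G2" "x \<in> ?Ge ` carrier ?G2" if "x \<in> carrier ?G1" for x
      using G_counit_comult[OF that] G_map_counit_comult[OF A that] s.add.hom_closed[OF that]
      by (metis imageI)+
    then show "?e1 ` carrier ?G2 = carrier ?G1" "?Ge ` carrier ?G2 = carrier ?G1" by auto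
  next
    fix k assume k: "k \<in> carrier ?G1" "g (?e k) = \<zero>\<^bsub>B\<^esub>"
    then have ek: "?e k = \<zero>\<^bsub>A\<^esub>" using g_zero by simp
    let ?h = "G_gen ?G1"
    let ?hz = "?h \<zero>\<^bsub>?G1\<^esub>"
    have h: "?h k \<in> carrier ?G2" "?hz \<in> carrier ?G2"
      using k by (auto intro: G_gen_closed)
    have h1: "?e1 (?h k) = k" "?e1 ?hz = \<zero>\<^bsub>?G1\<^esub>"
      using k by (simp_all add: G_counit_gen skew_brace_G)
    have h2: "?Ge (?h k) = ?Ge ?hz"
      using k ek by (simp add: G_map_gen sb_hom_funcset[OF e])
    have sk: "G_comult A k \<in> carrier ?G2" "?e1 (G_comult A k) = k" "?Ge (G_comult A k) = k"
      using k G_counit_comult[of k A] G_map_counit_comult[OF A, of k] s.add.hom_closed[of k] by auto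
    \<comment> \<open>\<open>G_comult A k\<close> has both faces equal to \<open>k\<close>. The
      difference \<open>?h k - ?hz\<close> has faces \<open>k\<close> and zero, the latter because
      \<open>?e k\<close> is zero; \<open>?hz\<close> is needed since the unit does not preserve
      zero.\<close>
    show "\<exists>u\<in>carrier ?G2. ?e1 u = \<zero>\<^bsub>?G1\<^esub> \<and> ?Ge u = k"
      using h h1 h2 sk k
      by (intro bexI[of _ "G_comult A k \<oplus>\<^bsub>?G2\<^esub> \<ominus>\<^bsub>?G2\<^esub> (?h k \<oplus>\<^bsub>?G2\<^esub> \<ominus>\<^bsub>?G2\<^esub> ?hz)"])
        (simp_all add: e.P.add_word)
  next
    fix u assume u: "u \<in> carrier ?G2" "?e1 u = \<zero>\<^bsub>?G1\<^esub>" "?Ge u = \<zero>\<^bsub>?G1\<^esub>"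
    let ?h = "G_gen ?G2"
    let ?hz = "?h \<zero>\<^bsub>?G2\<^esub>" and ?su = "G_comult ?G1 u" and ?tu = "?s1 u"
    have h: "?h u \<in> carrier ?G3" "?hz \<in> carrier ?G3"
      using u by (auto intro: G_gen_closed)
    have h1: "?e2 (?h u) = u" "?e2 ?hz = \<zero>\<^bsub>?G2\<^esub>"
      using u by (simp_all add: G_counit_gen skew_brace_G)
    have h2: "?Ge1 (?h u) = ?Ge1 ?hz" "?GGe (?h u) = ?GGe ?hz"
      using u by (simp_all add: G_map_gen sb_hom_funcset[OF e1] sb_hom_funcset[OF Ge])
    have su: "?su \<in> carrier ?G3" and tu: "?tu \<in> carrier ?G3"
      using u sb_hom_closed[OF s0] sb_hom_closed[OF s1] by auto
    have "?e2 ?su = u" "?Ge1 ?su = u" "?GGe ?su = G_comult A (?Ge u)"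
      using u G_counit_comult[of u ?G1] G_map_counit_comult[OF skew_brace_G, of u A]
        G_map_G_map_comult[OF sb_hom_funcset[OF e], of u] by auto
    moreover have "?e2 ?tu = G_comult A (?e1 u)"
      by (rule G_counit_natural[OF skew_brace_G skew_brace_G s u(1)])
    moreover have "?Ge1 ?tu = u"
      by (rule G_map_retract[OF sb_hom_funcset[OF s] sb_hom_funcset[OF e1] G_counit_comult u(1)])
    moreover have "?GGe ?tu = u"
      by (rule G_map_retract[OF sb_hom_funcset[OF s] sb_hom_funcset[OF Ge] G_map_counit_comult[OF A] u(1)])
    \<comment> \<open>In the order \<open>?e2\<close>, \<open>?Ge1\<close>, \<open>?GGe\<close>, the
      faces are u, 0, 0 for \<open>?h u - ?hz\<close>, then u, u, 0 for \<open>?su\<close>, and 0,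
      u, u for \<open>?tu\<close>. The first minus the second plus the third has faces 0, 0,
      u.\<close>
    ultimately show "\<exists>w\<in>carrier ?G3. ?e2 w = \<zero>\<^bsub>?G2\<^esub> \<and> ?Ge1 w = \<zero>\<^bsub>?G2\<^esub> \<and> ?GGe w = u"
      using h h1 h2 su tu u
      by (intro bexI[of _ "((?h u \<oplus>\<^bsub>?G3\<^esub> \<ominus>\<^bsub>?G3\<^esub> ?hz) \<oplus>\<^bsub>?G3\<^esub> \<ominus>\<^bsub>?G3\<^esub> ?su) \<oplus>\<^bsub>?G3\<^esub> ?tu"])
        (simp_all add: e1.P.add_word)
  qed
qed

section \<open>The Hopf formula\<close>

text \<open>Free skew braces are projective: generators are sent to chosen preimages under
  \<open>p'\<close>. Freeness of \<open>P\<close> is the bijectivity of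
  \<open>free_lift P (\<lambda>x. x)\<close>, so the extension is built on \<open>free_sb X\<close>
  and brought to \<open>P\<close> along the inverse of that map.\<close>

lemma free_presentation_lift:
  assumes P: "free_presentation P B p" and P': "free_presentation P' B p'" and B: "skew_brace B"
  obtains f where "f \<in> sb_hom P P'" "\<And>x. x \<in> carrier P \<Longrightarrow> p' (f x) = p x"
proof -
  have sb: "skew_brace P" "skew_brace P'" and p: "p \<in> sb_hom P B" and p': "p' \<in> sb_hom P' B"
    and surj: "p' ` carrier P' = carrier B"
    using P P' by (auto simp: free_presentation_def)
  obtain X where X: "X \<subseteq> carrier P"
    and bij: "bij_betw (free_lift P (\<lambda>x. x)) (carrier (free_sb X)) (carrier P)"
    using P by (auto simp: free_presentation_def is_free_on_def)
  let ?e = "free_lift P (\<lambda>x. x)"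
  have id: "(\<lambda>x. x) \<in> X \<rightarrow> carrier P" using X by auto
  define s where "s x = inv_into (carrier P') p' (p x)" for x
  have px: "p x \<in> p' ` carrier P'" if "x \<in> X" for x
    unfolding surj using X that sb_hom_closed[OF p] by auto
  have s: "s \<in> X \<rightarrow> carrier P'" "\<And>x. x \<in> X \<Longrightarrow> p' (s x) = p x"
    using inv_into_into[OF px] f_inv_into_f[OF px] by (simp_all add: s_def)
  note e = free_lift_hom[OF sb(1) id] and fs = free_lift_hom[OF sb(2) s(1)]
  have eq: "(p' \<circ> free_lift P' s) c = (p \<circ> ?e) c" if "c \<in> carrier (free_sb X)" for c
    by (rule free_sb_hom_unique[OF B sb_hom_comp[OF fs p'] sb_hom_comp[OF e p] _ that])
      (simp add: free_lift_gen[OF sb(1) id] free_lift_gen[OF sb(2) s(1)] s(2))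
  let ?i = "inv_into (carrier (free_sb X)) ?e"
  have i: "?i \<in> sb_hom P (free_sb X)"
    by (rule sb_hom_inv_into[OF skew_brace_free_sb e bij])
  show thesis
  proof (rule that)
    show "free_lift P' s \<circ> ?i \<in> sb_hom P P'" by (rule sb_hom_comp[OF i fs])
    show "p' ((free_lift P' s \<circ> ?i) x) = p x" if x: "x \<in> carrier P" for x
      using eq[OF sb_hom_closed[OF i x]] bij_betw_inv_into_right[OF bij x] by simp
  qed
qed

lemma free_presentation_hom:
  "\<lbrakk>free_presentation P B p; skew_brace B\<rbrakk> \<Longrightarrow> skew_brace_hom P B p"
  by (simp add: free_presentation_def skew_brace_hom_def skew_brace_hom_axioms_def)

lemma hopf_quotient_invariant:
  assumes B: "skew_brace B" and P: "free_presentation P B p" and P': "free_presentation P' B p'"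
  shows "hopf_quotient P (sb_kernel P B p) \<cong> hopf_quotient P' (sb_kernel P' B p')"
proof -
  obtain f where f: "f \<in> sb_hom P P'" "\<And>x. x \<in> carrier P \<Longrightarrow> p' (f x) = p x"
    using free_presentation_lift[OF P P' B] by blast
  obtain g where g: "g \<in> sb_hom P' P" "\<And>x. x \<in> carrier P' \<Longrightarrow> p (g x) = p' x"
    using free_presentation_lift[OF P' P B] by blast
  show ?thesis
    by (rule hopf_quotient_iso[OF free_presentation_hom[OF P B] free_presentation_hom[OF P' B] f g])
qed

lemma Base_transport:
  fixes B :: "'b ring"
  assumes B: "skew_brace B"
  defines "A \<equiv> image_ring Base B" and "g \<equiv> inv_into (carrier B) Base"
  shows "skew_brace A" "g \<in> sb_hom A B" "bij_betw g (carrier A) (carrier B)"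
    "b \<in> carrier B \<Longrightarrow> g (Base b) = b" "b \<in> carrier B \<Longrightarrow> Base b \<in> carrier A"
proof -
  have inj: "inj_on Base (carrier B)" by (simp add: inj_on_def)
  show "skew_brace A" "g \<in> sb_hom A B" "b \<in> carrier B \<Longrightarrow> g (Base b) = b"
    using skew_brace_image_ring[OF B inj] inv_image_ring_hom[OF B inj] inj
    by (simp_all add: A_def g_def)
  show "bij_betw g (carrier A) (carrier B)" "b \<in> carrier B \<Longrightarrow> Base b \<in> carrier A"
    using inj by (simp_all add: A_def g_def image_ring_carrier bij_betw_inv_into inj_on_imp_bij_betw)
qed

lemma comonadic_homology_1:
  assumes B: "skew_brace B"
  shows "comonadic_homology 1 B \<cong> add_monoid B Mod comm_Grp B (carrier B)"
  using aspherical_simplicial_skew_brace.homology_0[OF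
      G_aspherical[OF Base_transport(1)[OF B] B Base_transport(2,3)[OF B]]]
  by (simp add: comonadic_homology_def Let_def)

text \<open>\<open>homology_1\<close> yields the Hopf quotient of \<open>G_obj A\<close>, whose
  generators are tower elements. It is compared with the free skew brace on \<open>carrier B\<close>
  by the maps over \<open>B\<close> that \<open>g\<close> and \<open>Base\<close> induce on
  generators.\<close>

lemma comonadic_homology_2:
  fixes B :: "'b ring"
  assumes B: "skew_brace B"
  shows "comonadic_homology 2 B \<cong>
    hopf_quotient (free_sb (carrier B)) (sb_kernel (free_sb (carrier B)) B (free_lift B (\<lambda>b. b)))"
proof -
  define A where "A = image_ring Base B"
  define g where "g = inv_into (carrier B) Base"
  note A = Base_transport[OF B, folded A_def g_def]
  interpret aspherical_simplicial_skew_brace "G_simp A" "G_face A" B "\<lambda>w. g (G_counit A w)"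
    by (rule G_aspherical[OF A(1) B A(2,3)])
  let ?P = "free_sb (carrier B)" and ?p = "free_lift B (\<lambda>b. b)"
  let ?Q = "G_simp A 0" and ?q = "\<lambda>w. g (G_counit A w)"
  have id: "(\<lambda>b. b) \<in> carrier B \<rightarrow> carrier B" by simp
  have p: "?p \<in> sb_hom ?P B" by (rule free_lift_hom[OF B id])
  have q: "?q \<in> sb_hom ?Q B" by (rule p.hom)
  have P: "skew_brace_hom ?P B ?p"
    by (intro skew_brace_hom.intro skew_brace_hom_axioms.intro skew_brace_free_sb B p)
  have Q: "G_obj A = ?Q" by (simp add: G_simp_def)
  have fm: "(\<lambda>x. free_gen (carrier B) (g x)) \<in> carrier A \<rightarrow> carrier ?P"
    using sb_hom_closed[OF A(2)] by (auto intro: free_gen_closed)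
  have gm: "(\<lambda>b. G_gen A (Base b)) \<in> carrier B \<rightarrow> carrier ?Q"
    unfolding Q[symmetric] using A(5) by (auto intro: G_gen_closed)
  \<comment> \<open>This is the construction of \<open>G_lift\<close> written out, because the
    target does not live in the tower type.\<close>
  let ?f = "free_lift ?P (\<lambda>x. free_gen (carrier B) (g x)) \<circ> inv_into (carrier (free_sb (carrier A))) code_word"
  let ?g = "free_lift ?Q (\<lambda>b. G_gen A (Base b))"
  have f: "?f \<in> sb_hom ?Q ?P"
    unfolding Q[symmetric] G_obj_def
    by (rule sb_hom_comp[OF inv_image_ring_hom[OF skew_brace_free_sb inj_on_code_word]
          free_lift_hom[OF skew_brace_free_sb fm]])
  have f_gen: "?f (G_gen A x) = free_gen (carrier B) (g x)" if "x \<in> carrier A" for x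
    using free_lift_gen[OF skew_brace_free_sb fm that] inj_on_code_word[of "carrier A"]
      free_gen_closed[OF that] by (simp add: G_gen_def)
  have g: "?g \<in> sb_hom ?P ?Q" by (rule free_lift_hom[OF skew_brace_X gm])
  have pf: "?p (?f w) = ?q w" if "w \<in> carrier ?Q" for w
  proof -
    have "(?p \<circ> ?f) w = ?q w"
    proof (rule G_hom_eq[OF B _ _ _ that[folded Q]])
      show "?p \<circ> ?f \<in> sb_hom (G_obj A) B" "?q \<in> sb_hom (G_obj A) B"
        unfolding Q by (rule sb_hom_comp[OF f p], rule q)
      show "(?p \<circ> ?f) (G_gen A x) = ?q (G_gen A x)" if x: "x \<in> carrier A" for x
        using f_gen[OF x] free_lift_gen[OF B id sb_hom_closed[OF A(2) x]] G_counit_gen[OF A(1) x]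
        by simp
    qed
    then show ?thesis by simp
  qed
  have qg: "?q (?g c) = ?p c" if "c \<in> carrier ?P" for c
  proof -
    have "(?q \<circ> ?g) c = ?p c"
      by (rule free_sb_hom_unique[OF B sb_hom_comp[OF g q] p _ that])
        (simp add: free_lift_gen[OF skew_brace_X gm] free_lift_gen[OF B id] G_counit_gen A)
    then show ?thesis by simp
  qed
  have "comonadic_homology 2 B \<cong> hopf_quotient ?Q (sb_kernel ?Q B ?q)"
    using homology_1 by (simp add: comonadic_homology_def Let_def A_def One_nat_def)
  also have "\<dots> \<cong> hopf_quotient ?P (sb_kernel ?P B ?p)"
    by (rule hopf_quotient_iso[OF p.skew_brace_hom_axioms P f pf g qg])
  finally show ?thesis .
qed

theorem mainTheorem9:
  fixes B :: "'b ring"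
  assumes "skew_brace B"
  shows "comonadic_homology 1 B \<cong> add_monoid B Mod comm_Grp B (carrier B) \<and>
    (let P = free_sb (carrier B); p = free_lift B (\<lambda>b. b); K = sb_kernel P B p
     in comonadic_homology 2 B \<cong> hopf_quotient P K) \<and>
    (\<forall>(P :: 'p ring) p (P' :: 'q ring) p'.
       free_presentation P B p \<and> free_presentation P' B p' \<longrightarrow>
       hopf_quotient P (sb_kernel P B p) \<cong> hopf_quotient P' (sb_kernel P' B p'))"
  using comonadic_homology_1[OF assms] comonadic_homology_2[OF assms] hopf_quotient_invariant[OF assms]
  unfolding Let_def by blast

end
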